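(* Let $0<p<\infty$ and let $n$ be a positive integer. Every $f\in P^{n,p}(D,\mathbb{B})$ is an element of $L^m(D,\mathbb{B})$ for all $0<m<2p$.
   Context: $D$ is the open unit disk in $\mathbb{C}$. $\mathbb{B}$ denotes the bicomplex numbers: the commutative $\mathbb{C}$-algebra of elements $z_1+jz_2$ with $z_1,z_2\in\mathbb{C}$, $j^2=-1$, $ij=ji$. Put $p^\pm=\frac12(1\pm ij)$. Each $w=z_1+jz_2\in\mathbb{B}$ is uniquely $w=p^+w^++p^-w^-$ with $w^\pm=z_1\mp iz_2\in\mathbb{C}$, and $\|w\|_{\mathbb{B}}=\sqrt{(|w^+|^2+|w^-|^2)/2}$. For $0<m<\infty$, $L^m(D,\mathbb{B})$ is the set of $f:D\to\mathbb{B}$ with $\iint_D\|f\|_{\mathbb{B}}^m\,dx\,dy<\infty$. $\bar\partial=\frac12(\partial_x+j\partial_y)$. For $0<p<\infty$, $\|f\|_{H^p_{\mathbb{B}}}=\sup_{0<r<1}\left(\int_0^{2\pi}\|f(re^{i\theta})\|_{\mathbb{B}}^p\,d\theta\right)^{1/p}$. $P^n(D,\mathbb{B})$ is the set of $f:D\to\mathbb{B}$ with $\bar\partial^{\,n}f=0$ (classical derivatives, e.g. $f$ of class $C^n$), and $P^{n,p}(D,\mathbb{B})$ is the set of $f\in P^n(D,\mathbb{B})$ with $\sum_{k=0}^{n-1}\|\bar\partial^{\,k}f\|_{H^p_{\mathbb{B}}}<\infty$. *)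

theory Defs
  imports "HOL-Analysis.Analysis"
begin

section \<open>Bicomplex numbers\<close>

text \<open>\<open>Bicomplex z1 z2\<close> stands for \<open>z1 + j z2\<close>; see \<open>bicomplex_eq\<close>, \<open>bc_j_square\<close> and
  \<open>bicomplex_idempotent_decomposition\<close> below.\<close>

datatype bicomplex = Bicomplex (bc1: complex) (bc2: complex)

lemma bicomplex_eq_iff: "w = w' \<longleftrightarrow> bc1 w = bc1 w' \<and> bc2 w = bc2 w'"
  by (cases w; cases w') simp

instantiation bicomplex :: comm_ring_1
begin

definition zero_bicomplex :: bicomplex where "0 = Bicomplex 0 0"
definition one_bicomplex :: bicomplex where "1 = Bicomplex 1 0"
definition plus_bicomplex :: "bicomplex \<Rightarrow> bicomplex \<Rightarrow> bicomplex" where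
  "w + w' = Bicomplex (bc1 w + bc1 w') (bc2 w + bc2 w')"
definition uminus_bicomplex :: "bicomplex \<Rightarrow> bicomplex" where
  "- w = Bicomplex (- bc1 w) (- bc2 w)"
definition minus_bicomplex :: "bicomplex \<Rightarrow> bicomplex \<Rightarrow> bicomplex" where
  "w - w' = Bicomplex (bc1 w - bc1 w') (bc2 w - bc2 w')"
definition times_bicomplex :: "bicomplex \<Rightarrow> bicomplex \<Rightarrow> bicomplex" where
  "w * w' = Bicomplex (bc1 w * bc1 w' - bc2 w * bc2 w') (bc1 w * bc2 w' + bc2 w * bc1 w')"

instance
  by standard
    (simp_all add: bicomplex_eq_iff zero_bicomplex_def one_bicomplex_def plus_bicomplex_def
      uminus_bicomplex_def minus_bicomplex_def times_bicomplex_def algebra_simps)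

end

definition bc_plus :: "bicomplex \<Rightarrow> complex" where
  "bc_plus w = bc1 w - \<i> * bc2 w"

definition bc_minus :: "bicomplex \<Rightarrow> complex" where
  "bc_minus w = bc1 w + \<i> * bc2 w"

instantiation bicomplex :: real_normed_vector
begin

definition scaleR_bicomplex :: "real \<Rightarrow> bicomplex \<Rightarrow> bicomplex" where
  "c *\<^sub>R w = Bicomplex (c *\<^sub>R bc1 w) (c *\<^sub>R bc2 w)"
definition norm_bicomplex :: "bicomplex \<Rightarrow> real" where
  "norm w = sqrt (((norm (bc_plus w))\<^sup>2 + (norm (bc_minus w))\<^sup>2) / 2)"
definition sgn_bicomplex :: "bicomplex \<Rightarrow> bicomplex" where
  "sgn (w :: bicomplex) = inverse (norm w) *\<^sub>R w"
definition dist_bicomplex :: "bicomplex \<Rightarrow> bicomplex \<Rightarrow> real" where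
  "dist (w :: bicomplex) w' = norm (w - w')"
definition uniformity_bicomplex :: "(bicomplex \<times> bicomplex) filter" where
  "uniformity = (INF e\<in>{0<..}. principal {(x :: bicomplex, y). dist x y < e})"
definition open_bicomplex :: "bicomplex set \<Rightarrow> bool" where
  "open (U :: bicomplex set) \<longleftrightarrow> (\<forall>x\<in>U. eventually (\<lambda>(x', y). x' = x \<longrightarrow> y \<in> U) uniformity)"

instance
proof
  fix w w' :: bicomplex and a b :: real
  show "a *\<^sub>R (w + w') = a *\<^sub>R w + a *\<^sub>R w'" "(a + b) *\<^sub>R w = a *\<^sub>R w + b *\<^sub>R w"
    "a *\<^sub>R b *\<^sub>R w = (a * b) *\<^sub>R w" "1 *\<^sub>R w = w"
    by (simp_all add: bicomplex_eq_iff scaleR_bicomplex_def plus_bicomplex_def algebra_simps)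
  have norm_eq: "norm v = norm (bc_plus v, bc_minus v) / sqrt 2" for v
    by (simp add: norm_bicomplex_def norm_Pair real_sqrt_divide)
  have "bc1 w = 0 \<and> bc2 w = 0" if "bc_plus w = 0" "bc_minus w = 0"
  proof -
    have "bc1 w = (bc_plus w + bc_minus w) / 2" "\<i> * bc2 w = (bc_minus w - bc_plus w) / 2"
      by (simp_all add: bc_plus_def bc_minus_def)
    with that show ?thesis by simp
  qed
  then show "norm w = 0 \<longleftrightarrow> w = 0"
    by (auto simp: norm_eq zero_bicomplex_def bicomplex_eq_iff bc_plus_def bc_minus_def
        zero_prod_def)
  have "(bc_plus (w + w'), bc_minus (w + w'))
      = (bc_plus w, bc_minus w) + (bc_plus w', bc_minus w')"
    by (simp add: bc_plus_def bc_minus_def plus_bicomplex_def algebra_simps)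
  then show "norm (w + w') \<le> norm w + norm w'"
    unfolding norm_eq by (metis add_divide_distrib divide_right_mono norm_triangle_ineq
        real_sqrt_ge_0_iff zero_le_numeral)
  have "(bc_plus (a *\<^sub>R w), bc_minus (a *\<^sub>R w)) = a *\<^sub>R (bc_plus w, bc_minus w)"
    by (simp add: bc_plus_def bc_minus_def scaleR_bicomplex_def algebra_simps)
  then show "norm (a *\<^sub>R w) = \<bar>a\<bar> * norm w"
    unfolding norm_eq by (metis norm_scaleR times_divide_eq_right)
qed (simp_all add: sgn_bicomplex_def dist_bicomplex_def uniformity_bicomplex_def
    open_bicomplex_def)

end

definition bc_of_complex :: "complex \<Rightarrow> bicomplex" where
  "bc_of_complex z = Bicomplex z 0"

definition bc_j :: bicomplex where
  "bc_j = Bicomplex 0 1"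

definition bc_p_plus :: bicomplex where
  "bc_p_plus = (1/2) *\<^sub>R (1 + bc_of_complex \<i> * bc_j)"

definition bc_p_minus :: bicomplex where
  "bc_p_minus = (1/2) *\<^sub>R (1 - bc_of_complex \<i> * bc_j)"

lemma bc_j_square: "bc_j * bc_j = -1"
  by (simp add: bc_j_def times_bicomplex_def one_bicomplex_def uminus_bicomplex_def)

lemma bicomplex_eq: "Bicomplex z1 z2 = bc_of_complex z1 + bc_j * bc_of_complex z2"
  by (simp add: bc_j_def bc_of_complex_def times_bicomplex_def plus_bicomplex_def)

lemma bicomplex_idempotent_decomposition:
  "w = bc_p_plus * bc_of_complex (bc_plus w) + bc_p_minus * bc_of_complex (bc_minus w)"
  by (simp add: bicomplex_eq_iff bc_p_plus_def bc_p_minus_def bc_j_def bc_of_complex_def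
      bc_plus_def bc_minus_def times_bicomplex_def plus_bicomplex_def minus_bicomplex_def
      one_bicomplex_def scaleR_bicomplex_def complex_eq_iff field_simps)


section \<open>Function spaces on the unit disk\<close>

text \<open>Functions on the disk \<open>D = ball 0 1\<close> are represented by total functions on
  \<^typ>\<open>complex\<close>; nothing below depends on their values outside \<open>D\<close>.\<close>

definition partial_x :: "(complex \<Rightarrow> bicomplex) \<Rightarrow> complex \<Rightarrow> bicomplex" where
  "partial_x f z = vector_derivative (\<lambda>t::real. f (z + of_real t)) (at 0)"

definition partial_y :: "(complex \<Rightarrow> bicomplex) \<Rightarrow> complex \<Rightarrow> bicomplex" where
  "partial_y f z = vector_derivative (\<lambda>t::real. f (z + \<i> * of_real t)) (at 0)"

primrec C_on_disk :: "nat \<Rightarrow> (complex \<Rightarrow> bicomplex) \<Rightarrow> bool" where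
  "C_on_disk 0 f \<longleftrightarrow> continuous_on (ball 0 1) f"
| "C_on_disk (Suc k) f \<longleftrightarrow>
     continuous_on (ball 0 1) f \<and>
     (\<forall>z\<in>ball 0 1. (\<lambda>t::real. f (z + of_real t)) differentiable (at 0) \<and>
                    (\<lambda>t::real. f (z + \<i> * of_real t)) differentiable (at 0)) \<and>
     C_on_disk k (partial_x f) \<and> C_on_disk k (partial_y f)"

definition dbar :: "(complex \<Rightarrow> bicomplex) \<Rightarrow> complex \<Rightarrow> bicomplex" where
  "dbar f z = (1/2) *\<^sub>R (partial_x f z + bc_j * partial_y f z)"

definition P_space :: "nat \<Rightarrow> (complex \<Rightarrow> bicomplex) set" where
  "P_space n = {f. C_on_disk n f \<and> (\<forall>z\<in>ball 0 1. (dbar ^^ n) f z = 0)}"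

text \<open>Powers of extended nonnegative reals, for exponents \<open>q > 0\<close> only.\<close>

definition ennreal_powr :: "ennreal \<Rightarrow> real \<Rightarrow> ennreal" where
  "ennreal_powr x q = (if x = \<infinity> then \<infinity> else ennreal (enn2real x powr q))"

definition hardy_norm :: "real \<Rightarrow> (complex \<Rightarrow> bicomplex) \<Rightarrow> ennreal" where
  "hardy_norm p f =
     (SUP r\<in>{0<..<1}. ennreal_powr
        (\<integral>\<^sup>+\<theta>\<in>{0..2*pi}. ennreal (norm (f (of_real r * cis \<theta>)) powr p) \<partial>lborel) (1/p))"

definition P_hardy_space :: "nat \<Rightarrow> real \<Rightarrow> (complex \<Rightarrow> bicomplex) set" where
  "P_hardy_space n p = {f \<in> P_space n. (\<Sum>k<n. hardy_norm p ((dbar ^^ k) f)) < \<infinity>}"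

definition L_space :: "real \<Rightarrow> (complex \<Rightarrow> bicomplex) set" where
  "L_space m = {f. f \<in> borel_measurable (lebesgue_on (ball 0 1)) \<and>
     (\<integral>\<^sup>+z. ennreal (norm (f z) powr m) \<partial>lebesgue_on (ball 0 1)) < \<infinity>}"

end

theory Submission
  imports Defs "HOL-Complex_Analysis.Cauchy_Integral_Formula"
begin

text \<open>The components \<open>bc_minus f\<close> and \<open>cnj (bc_plus f)\<close> control the norm of \<open>f\<close>, and on each of them the
  operator \<open>dbar\<close> acts as the ordinary derivative with respect to \<open>cnj z\<close>
  (\<open>component_has_derivative\<close>). So the claim is one about complex polyanalytic functions \<open>u\<close> on the disk
  all of whose derivatives with respect to \<open>cnj z\<close> of order below \<open>n\<close> have bounded \<open>p\<close>-means on
  circles.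

  Such a function differs from a holomorphic function with bounded \<open>p\<close>-means, namely the sum of
  \<open>(- cnj z) ^ k / fact k\<close> times its \<open>k\<close>-th derivative over \<open>k < n\<close>, by bounded multiples of its higher
  derivatives. These are polyanalytic of lower order, so induction reduces everything to the
  holomorphic case (\<open>Wirtinger_chain_integral_finite\<close>).

  A holomorphic \<open>g\<close> with bounded \<open>p\<close>-means satisfies \<open>|g z| powr p * (1 - |z|) \<le> K\<close> (\<open>Hardy_growth\<close>).
  For \<open>p < m < 2 p\<close> this gives
  \<open>|g z| powr m \<le> const * |g z| powr p * (1 - |z|) powr (- s)\<close> with \<open>s = (m - p)/p < 1\<close>. Integrating
  over circles first leaves the integral of \<open>(1 - |z|) powr (- s)\<close> over the disk
  (\<open>nn_integral_radial_weight_le\<close>), which is finite because \<open>s < 1\<close>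
  (\<open>nn_integral_ball_powr_finite\<close>). Smaller exponents follow since the disk has finite area.\<close>

section \<open>Rotation invariance and radial weights\<close>

lemma nn_integral_lborel_translate:
  fixes t :: "'a::euclidean_space"
  assumes [measurable]: "f \<in> borel_measurable borel"
  shows "(\<integral>\<^sup>+x. f (t + x) \<partial>lborel) = (\<integral>\<^sup>+x. f x \<partial>lborel)"
  by (subst (2) lborel_distr_plus[of t, symmetric]) (simp add: nn_integral_distr)

lemma nn_integral_lborel_reflect:
  fixes t :: "'a::euclidean_space"
  assumes [measurable]: "f \<in> borel_measurable borel"
  shows "(\<integral>\<^sup>+x. f (t - x) \<partial>lborel) = (\<integral>\<^sup>+x. f x \<partial>lborel)"
  by (subst (2) lborel_affine[of "-1" t]) (simp_all add: nn_integral_density nn_integral_distr)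

text \<open>Rotation invariance of planar Lebesgue measure, by uniqueness of translation-invariant measures.
  The rotated measure \<open>\<mu>\<close> is translation invariant as well, so computing the double integral of
  \<open>1\<^sub>A(x) 1\<^sub>B(x + y)\<close> with respect to \<open>\<mu>\<close> in \<open>x\<close> and Lebesgue measure \<open>\<lambda>\<close> in \<open>y\<close> in both orders gives
  \<open>\<mu>(A) \<lambda>(B) = \<mu>(B) \<lambda>(A)\<close>; the second order also uses that \<open>\<lambda>\<close> is invariant under reflections. Taking for \<open>B\<close> the unit disk, which the rotation preserves, gives
  \<open>\<mu>(A) = \<lambda>(A)\<close>.\<close>

lemma distr_lborel_mult_unit:
  fixes c :: complex
  assumes c: "norm c = 1"
  shows "distr lborel borel ((*) c) = lborel"
proof (rule measure_eqI)
  fix A :: "complex set"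
  assume "A \<in> sets (distr lborel borel ((*) c))"
  then have A[measurable]: "A \<in> sets borel" by simp
  define B :: "complex set" where "B = ball 0 1"
  have B[measurable]: "B \<in> sets borel" by (simp add: B_def)
  have c0: "c \<noteq> 0" using c by auto
  have mu: "(\<integral>\<^sup>+x. f x \<partial>distr lborel borel ((*) c)) = (\<integral>\<^sup>+x. f (c * x) \<partial>lborel)"
    if [measurable]: "f \<in> borel_measurable borel" for f :: "complex \<Rightarrow> ennreal"
    by (simp add: nn_integral_distr)
  have "emeasure (distr lborel borel ((*) c)) A * emeasure lborel B
      = (\<integral>\<^sup>+x. indicator A (c * x) \<partial>lborel) * (\<integral>\<^sup>+y. indicator B y \<partial>lborel)"
    using mu[of "indicator A"] by simp
  also have "\<dots> = (\<integral>\<^sup>+x. (\<integral>\<^sup>+y. indicator A (c * x) * indicator B y \<partial>lborel) \<partial>lborel)"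
    by (simp add: nn_integral_multc nn_integral_cmult)
  also have "\<dots> = (\<integral>\<^sup>+x. (\<integral>\<^sup>+y. indicator A (c * x) * indicator B (c * x + y) \<partial>lborel) \<partial>lborel)"
    by (intro nn_integral_cong nn_integral_lborel_translate[symmetric]) simp
  also have "\<dots> = (\<integral>\<^sup>+y. (\<integral>\<^sup>+x. indicator A (c * x) * indicator B (c * x + y) \<partial>lborel) \<partial>lborel)"
    by (rule lborel_pair.Fubini') simp
  also have "\<dots> = (\<integral>\<^sup>+y. (\<integral>\<^sup>+x. indicator A (c * x - y) * indicator B (c * x) \<partial>lborel) \<partial>lborel)"
  proof (rule nn_integral_cong)
    fix y :: complex
    have "(\<integral>\<^sup>+x. indicator A (c * x - y) * indicator B (c * x) \<partial>lborel)
        = (\<integral>\<^sup>+x. indicator A (c * (y / c + x) - y) * indicator B (c * (y / c + x)) \<partial>lborel)"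
      by (rule nn_integral_lborel_translate[symmetric]) simp
    also have "\<dots> = (\<integral>\<^sup>+x. indicator A (c * x) * indicator B (c * x + y) \<partial>lborel)"
      using c0 by (simp add: ring_distribs add.commute)
    finally show "(\<integral>\<^sup>+x. indicator A (c * x) * indicator B (c * x + y) \<partial>lborel)
        = (\<integral>\<^sup>+x. indicator A (c * x - y) * indicator B (c * x) \<partial>lborel)" ..
  qed
  also have "\<dots> = (\<integral>\<^sup>+x. (\<integral>\<^sup>+y. indicator A (c * x - y) * indicator B (c * x) \<partial>lborel) \<partial>lborel)"
    by (rule lborel_pair.Fubini') simp
  also have "\<dots> = (\<integral>\<^sup>+x. (\<integral>\<^sup>+y. indicator A y * indicator B (c * x) \<partial>lborel) \<partial>lborel)"
    by (intro nn_integral_cong nn_integral_lborel_reflect) simp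
  also have "\<dots> = emeasure lborel A * (\<integral>\<^sup>+x. indicator B (c * x) \<partial>lborel)"
    by (simp add: nn_integral_multc nn_integral_cmult)
  also have "(\<integral>\<^sup>+x. indicator B (c * x) \<partial>lborel) = (\<integral>\<^sup>+x. indicator B x \<partial>lborel)"
    using c by (simp add: B_def indicator_def norm_mult)
  finally have "emeasure (distr lborel borel ((*) c)) A * emeasure lborel B
      = emeasure lborel A * emeasure lborel B" by simp
  moreover have "emeasure lborel B = ennreal pi"
    by (simp add: B_def emeasure_ball unit_ball_vol_2)
  ultimately show "emeasure (distr lborel borel ((*) c)) A = emeasure lborel A"
    by (simp add: mult.commute[of _ "ennreal pi"] ennreal_mult_cancel_left)
qed simp

lemma nn_integral_lborel_mult_unit:
  fixes c :: complex
  assumes "norm c = 1" and [measurable]: "f \<in> borel_measurable borel"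
  shows "(\<integral>\<^sup>+x. f (c * x) \<partial>lborel) = (\<integral>\<^sup>+x. f x \<partial>lborel)"
  by (subst (2) distr_lborel_mult_unit[OF assms(1), symmetric]) (simp add: nn_integral_distr)

text \<open>With \<open>z = |z| cis a\<close> the left-hand side is an integral of a \<open>2\<pi>\<close>-periodic function over
  \<open>[a, a + 2\<pi>]\<close>. Covering this interval by two periods avoids splitting it, and the factor 2 is
  harmless in what follows.\<close>

lemma nn_integral_rotate_le:
  fixes F :: "complex \<Rightarrow> ennreal"
  assumes [measurable]: "F \<in> borel_measurable borel"
  shows "(\<integral>\<^sup>+\<theta>\<in>{0..2*pi}. F (cis \<theta> * z) \<partial>lborel)
    \<le> 2 * (\<integral>\<^sup>+\<theta>\<in>{0..2*pi}. F (of_real (norm z) * cis \<theta>) \<partial>lborel)"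
proof -
  define a where "a = Arg2pi z"
  define G where "G \<theta> = F (of_real (norm z) * cis \<theta>)" for \<theta>
  have [measurable]: "cis \<in> borel_measurable borel"
    by (intro borel_measurable_continuous_onI continuous_intros)
  have [measurable]: "G \<in> borel_measurable borel" unfolding G_def by measurable
  have a: "0 \<le> a" "a < 2 * pi" by (simp_all add: a_def Arg2pi_ge_0 Arg2pi_lt_2pi)
  have z: "cis \<theta> * z = of_real (norm z) * cis (a + \<theta>)" for \<theta>
  proof -
    have "z = of_real (norm z) * cis a"
      using Arg2pi_eq[of z] by (simp add: a_def cis_conv_exp)
    then show ?thesis by (metis cis_mult mult.assoc mult.commute)
  qed
  have "(\<integral>\<^sup>+\<theta>\<in>{0..2*pi}. F (cis \<theta> * z) \<partial>lborel)
      = (\<integral>\<^sup>+\<theta>. G (a + \<theta>) * indicator {0..2*pi} (-a + (a + \<theta>)) \<partial>lborel)"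
    by (simp add: z G_def)
  also have "\<dots> = (\<integral>\<^sup>+\<theta>. G \<theta> * indicator {0..2*pi} (-a + \<theta>) \<partial>lborel)"
    by (rule nn_integral_lborel_translate) simp
  also have "\<dots> \<le> (\<integral>\<^sup>+\<theta>. G \<theta> * indicator {0..2*pi} \<theta>
      + G \<theta> * indicator {0..2*pi} (-(2*pi) + \<theta>) \<partial>lborel)"
    using a by (intro nn_integral_mono) (auto simp: indicator_def)
  also have "\<dots> = (\<integral>\<^sup>+\<theta>. G \<theta> * indicator {0..2*pi} \<theta> \<partial>lborel)
      + (\<integral>\<^sup>+\<theta>. G \<theta> * indicator {0..2*pi} (-(2*pi) + \<theta>) \<partial>lborel)"
    by (intro nn_integral_add) simp_all
  also have "(\<integral>\<^sup>+\<theta>. G \<theta> * indicator {0..2*pi} (-(2*pi) + \<theta>) \<partial>lborel)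
      = (\<integral>\<^sup>+\<theta>. G (2*pi + \<theta>) * indicator {0..2*pi} (-(2*pi) + (2*pi + \<theta>)) \<partial>lborel)"
    by (rule nn_integral_lborel_translate[symmetric]) simp
  also have "\<dots> = (\<integral>\<^sup>+\<theta>. G \<theta> * indicator {0..2*pi} \<theta> \<partial>lborel)"
    by (simp add: G_def cis_mult[symmetric])
  finally show ?thesis unfolding G_def mult_2[where 'a = ennreal] .
qed

text \<open>This plays the role of integration in polar coordinates: averaging the area integral over all
  rotations \<open>z \<mapsto> cis \<theta> z\<close> leaves it unchanged, and exchanging the integrals replaces \<open>F\<close>
  by its mean over the circle through \<open>z\<close>.\<close>

lemma nn_integral_radial_weight_le:
  fixes F :: "complex \<Rightarrow> ennreal" and w :: "real \<Rightarrow> ennreal"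
  assumes [measurable]: "F \<in> borel_measurable borel" "w \<in> borel_measurable borel"
    and C: "\<And>r. 0 < r \<Longrightarrow> r < 1 \<Longrightarrow> (\<integral>\<^sup>+\<theta>\<in>{0..2*pi}. F (of_real r * cis \<theta>) \<partial>lborel) \<le> ennreal C"
  shows "(\<integral>\<^sup>+z\<in>ball 0 1. w (norm z) * F z \<partial>lborel) * ennreal (2 * pi)
    \<le> 2 * ennreal C * (\<integral>\<^sup>+z\<in>ball 0 1. w (norm (z::complex)) \<partial>lborel)"
proof -
  have [measurable]: "cis \<in> borel_measurable borel"
    by (intro borel_measurable_continuous_onI continuous_intros)
  have [measurable]: "ball 0 1 \<in> sets (borel :: complex measure)" by simp
  define H where "H z = w (norm z) * F z * indicator (ball 0 1) z" for z
  have [measurable]: "H \<in> borel_measurable borel" unfolding H_def by measurable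
  have "(\<integral>\<^sup>+z. H z \<partial>lborel) * ennreal (2 * pi)
      = (\<integral>\<^sup>+\<theta>\<in>{0..2*pi}. (\<integral>\<^sup>+z. H z \<partial>lborel) \<partial>lborel)"
    by (simp add: nn_integral_cmult)
  also have "\<dots> = (\<integral>\<^sup>+\<theta>. (\<integral>\<^sup>+z. H (cis \<theta> * z) \<partial>lborel) * indicator {0..2*pi} \<theta> \<partial>lborel)"
    by (simp add: nn_integral_lborel_mult_unit)
  also have "\<dots> = (\<integral>\<^sup>+\<theta>. (\<integral>\<^sup>+z. H (cis \<theta> * z) * indicator {0..2*pi} \<theta> \<partial>lborel) \<partial>lborel)"
    by (intro nn_integral_cong nn_integral_multc[symmetric]) simp
  also have "\<dots> = (\<integral>\<^sup>+z. (\<integral>\<^sup>+\<theta>. H (cis \<theta> * z) * indicator {0..2*pi} \<theta> \<partial>lborel) \<partial>lborel)"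
    by (rule lborel_pair.Fubini') simp
  also have "\<dots> \<le> (\<integral>\<^sup>+z. 2 * ennreal C * (w (norm (z::complex)) * indicator (ball 0 1) z) \<partial>lborel)"
  proof (rule nn_integral_mono_AE)
    show "AE z in lborel. (\<integral>\<^sup>+\<theta>. H (cis \<theta> * z) * indicator {0..2*pi} \<theta> \<partial>lborel)
        \<le> 2 * ennreal C * (w (norm z) * indicator (ball 0 1) z)"
      using AE_lborel_singleton[of "0::complex"]
    proof eventually_elim
      fix z :: complex assume z: "z \<noteq> 0"
      have "(\<integral>\<^sup>+\<theta>. H (cis \<theta> * z) * indicator {0..2*pi} \<theta> \<partial>lborel)
          = (\<integral>\<^sup>+\<theta>. (w (norm z) * indicator (ball 0 1) z) * (F (cis \<theta> * z) * indicator {0..2*pi} \<theta>) \<partial>lborel)"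
        by (intro nn_integral_cong) (simp add: H_def norm_mult indicator_def)
      also have "\<dots> = (w (norm z) * indicator (ball 0 1) z) * (\<integral>\<^sup>+\<theta>\<in>{0..2*pi}. F (cis \<theta> * z) \<partial>lborel)"
        by (rule nn_integral_cmult) simp
      also have "\<dots> \<le> (w (norm z) * indicator (ball 0 1) z) * (2 * ennreal C)"
      proof (cases "norm z < 1")
        case True
        have "(\<integral>\<^sup>+\<theta>\<in>{0..2*pi}. F (cis \<theta> * z) \<partial>lborel) \<le> 2 * ennreal C"
          using nn_integral_rotate_le[OF assms(1), of z] C[of "norm z"] z True
          by (meson mult_left_mono order_trans zero_less_norm_iff zero_le)
        then show ?thesis by (intro mult_left_mono) simp_all
      qed simp
      finally show "(\<integral>\<^sup>+\<theta>. H (cis \<theta> * z) * indicator {0..2*pi} \<theta> \<partial>lborel)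
          \<le> 2 * ennreal C * (w (norm z) * indicator (ball 0 1) z)" by (simp add: mult.commute)
    qed
  qed
  also have "\<dots> = 2 * ennreal C * (\<integral>\<^sup>+z. w (norm (z::complex)) * indicator (ball 0 1) z \<partial>lborel)"
    by (rule nn_integral_cmult) simp
  finally show ?thesis unfolding H_def .
qed

text \<open>Dyadic decomposition: on the annulus \<open>1 - 2 powr (- k) \<le> |z| < 1\<close>, of area at most \<open>2\<pi> 2 powr (- k)\<close>,
  those points with \<open>1 - |z| > 2 powr (- k - 1)\<close> have weight at most \<open>2 powr (s * (k + 1))\<close>. The resulting
  series is geometric with ratio \<open>2 powr (s - 1)\<close>.\<close>

lemma nn_integral_ball_powr_finite:
  assumes s: "0 < s" "s < 1"
  shows "(\<integral>\<^sup>+z\<in>ball 0 1. ennreal ((1 - norm (z::complex)) powr (- s)) \<partial>lborel) < \<infinity>"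
proof -
  define A :: "nat \<Rightarrow> complex set" where "A k = ball 0 1 - ball 0 (1 - (1/2)^k)" for k
  have [measurable]: "A k \<in> sets borel" for k by (simp add: A_def)
  have emA: "emeasure lborel (A k) \<le> ennreal (2 * pi * (1/2)^k)" for k
  proof -
    define h :: real where "h = (1/2)^k"
    have h: "0 < h" "h \<le> 1" by (simp_all add: h_def power_le_one)
    have "emeasure lborel (A k) = emeasure lborel (ball (0::complex) 1) - emeasure lborel (ball (0::complex) (1 - h))"
      unfolding A_def h_def[symmetric] using h by (intro emeasure_Diff) (auto simp: emeasure_ball)
    also have "\<dots> = ennreal (pi - pi * (1 - h)^2)"
      using h by (simp add: emeasure_ball unit_ball_vol_2 ennreal_minus)
    also have "\<dots> \<le> ennreal (2 * pi * h)"
      using h by (intro ennreal_leI) (simp add: power2_eq_square field_simps)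
    finally show ?thesis by (simp add: h_def)
  qed
  define q where "q = 2 powr (s - 1)"
  have q: "0 < q" "q < 1" using s by (simp_all add: q_def powr_less_one)
  have term_eq: "2 powr (s * (real k + 1)) * (2 * pi * (1/2)^k) = (2 * pi * 2 powr s) * q ^ k" for k :: nat
  proof -
    have q_pow: "q ^ k = 2 powr ((s - 1) * k)" by (simp add: q_def powr_power mult.commute)
    have half_pow: "(1/2::real) ^ k = 2 powr (- real k)"
      by (simp add: power_one_over powr_minus_divide powr_realpow)
    have "2 powr (s * (real k + 1)) * 2 powr (- real k) = 2 powr s * 2 powr ((s - 1) * k)"
      by (simp add: algebra_simps flip: powr_add)
    then show ?thesis unfolding q_pow half_pow by (simp add: mult_ac)
  qed
  have term_le_suminf: "f k \<le> suminf f" for f :: "nat \<Rightarrow> ennreal" and k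
    using sum_le_suminf[of f "{k}"] by simp
  have "(\<integral>\<^sup>+z\<in>ball 0 1. ennreal ((1 - norm (z::complex)) powr (- s)) \<partial>lborel)
      \<le> (\<integral>\<^sup>+z. (\<Sum>k. ennreal (2 powr (s * (real k + 1))) * indicator (A k) z) \<partial>lborel)"
  proof (rule nn_integral_mono)
    fix z :: complex
    show "ennreal ((1 - norm z) powr (- s)) * indicator (ball 0 1) z
        \<le> (\<Sum>k. ennreal (2 powr (s * (real k + 1))) * indicator (A k) z)"
    proof (cases "z \<in> ball 0 1")
      case True
      define d where "d = 1 - norm z"
      have d: "0 < d" "d \<le> 1" using True by (auto simp: d_def)
      have ex: "\<exists>k. (1/2)^(Suc k) < d"
      proof -
        obtain k where "(1/2)^k < d" using real_arch_pow_inv[of d "1/2"] d by auto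
        moreover have "(1/2::real)^(Suc k) \<le> (1/2)^k" by simp
        ultimately show ?thesis by (meson le_less_trans)
      qed
      define k where "k = (LEAST k. (1/2)^(Suc k) < d)"
      have k1: "(1/2)^(Suc k) < d" unfolding k_def by (rule LeastI_ex[OF ex])
      have k2: "d \<le> (1/2)^k"
      proof (cases k)
        case (Suc i)
        then have "\<not> (1/2)^(Suc i) < d" using not_less_Least[of i "\<lambda>k. (1/2)^(Suc k) < d"]
          by (simp add: k_def)
        then show ?thesis using Suc by simp
      qed (use d in simp)
      have zA: "z \<in> A k" using True k2 by (auto simp: A_def d_def)
      have "d powr (- s) \<le> ((1/2)^(Suc k)) powr (- s)"
        using k1 d s by (intro powr_mono2') simp_all
      also have "((1/2::real)^(Suc k)) = 2 powr (- (k + 1))"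
        using powr_realpow[of "2::real" "Suc k"] powr_minus_divide[of "2::real" "1 + real k"]
        by (simp add: power_one_over)
      also have "(2 powr (- (k + 1))) powr (- s) = 2 powr (s * (real k + 1))"
        by (simp add: powr_powr algebra_simps)
      finally have "ennreal (d powr (- s)) * indicator (ball 0 1) z \<le> ennreal (2 powr (s * (real k + 1))) * indicator (A k) z"
        using zA True by (simp add: ennreal_leI)
      also have "\<dots> \<le> (\<Sum>k. ennreal (2 powr (s * (real k + 1))) * indicator (A k) z)"
        by (rule term_le_suminf[of "\<lambda>k. ennreal (2 powr (s * (real k + 1))) * indicator (A k) z"])
      finally show ?thesis by (simp add: d_def)
    qed simp
  qed
  also have "\<dots> = (\<Sum>k. ennreal (2 powr (s * (real k + 1))) * emeasure lborel (A k))"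
    by (subst nn_integral_suminf) (simp_all add: nn_integral_cmult_indicator)
  also have "\<dots> \<le> (\<Sum>k. ennreal ((2 * pi * 2 powr s) * q ^ k))"
  proof (rule suminf_le)
    fix k
    have "ennreal (2 powr (s * (real k + 1))) * emeasure lborel (A k)
        \<le> ennreal (2 powr (s * (real k + 1))) * ennreal (2 * pi * (1/2)^k)"
      by (intro mult_left_mono emA) simp
    also have "\<dots> = ennreal ((2 * pi * 2 powr s) * q ^ k)"
      unfolding term_eq[symmetric] by (rule ennreal_mult[symmetric]) simp_all
    finally show "ennreal (2 powr (s * (real k + 1))) * emeasure lborel (A k) \<le> ennreal ((2 * pi * 2 powr s) * q ^ k)" .
  qed simp_all
  also have "\<dots> = ennreal (\<Sum>k. (2 * pi * 2 powr s) * q ^ k)"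
    using q by (intro suminf_ennreal2 summable_mult summable_geometric) simp_all
  also have "\<dots> < \<infinity>" by simp
  finally show ?thesis .
qed

section \<open>Growth of functions in the Hardy space\<close>

text \<open>For an exponent \<open>q < 1\<close> the growth bound follows from Cauchy's formula alone. At a point \<open>z0\<close> where
  \<open>|g w| (R - |w|) powr (1/q)\<close> attains its maximum \<open>S\<close> over \<open>|w| \<le> R\<close>, Cauchy's formula on the
  circle halfway between \<open>|z0|\<close> and \<open>R\<close> bounds \<open>g z0\<close> by the mean of
  \<open>|g| = |g| powr (1 - q) * |g| powr q\<close>. The first factor is controlled by \<open>S\<close> itself, the second by \<open>C\<close>,
  and the powers of \<open>R - |z0|\<close> cancel, leaving \<open>S powr q \<le> const * C\<close>.\<close>

lemma Hardy_growth_lt_1: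
  fixes g :: "complex \<Rightarrow> complex"
  assumes hol: "g holomorphic_on ball 0 1" and q: "0 < q" "q < 1" and C0: "0 \<le> C"
    and C: "\<And>r. 0 < r \<Longrightarrow> r < 1 \<Longrightarrow>
      (\<integral>\<^sup>+\<theta>\<in>{0..2*pi}. ennreal (norm (g (of_real r * cis \<theta>)) powr q) \<partial>lborel) \<le> ennreal C"
    and z: "norm z < 1"
  shows "norm (g z) powr q * (1 - norm z) \<le> C * 2 powr (1/q) / pi"
proof -
  \<comment> \<open>Working inside \<open>cball 0 R\<close> with \<open>R < 1\<close> guarantees that the maximum exists; this choice of \<open>R\<close> costs a factor 2.\<close>
  define R where "R = (1 + norm z) / 2"
  have R: "0 < R" "norm z < R" "R < 1" using z by (simp_all add: R_def add_pos_nonneg)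
  define \<phi> where "\<phi> w = norm (g w) * (R - norm w) powr (1/q)" for w
  have contg: "continuous_on (ball 0 1) g" using hol by (rule holomorphic_on_imp_continuous_on)
  have "continuous_on (cball 0 R) \<phi>" unfolding \<phi>_def
    using R q by (intro continuous_intros continuous_on_powr' continuous_on_subset[OF contg]) auto
  then obtain z0 where z0: "norm z0 \<le> R" and max: "\<And>w. norm w \<le> R \<Longrightarrow> \<phi> w \<le> \<phi> z0"
    using continuous_attains_sup[of "cball 0 R" \<phi>] R by (auto simp: compact_cball)
  define S where "S = \<phi> z0"
  have S0: "0 \<le> S" by (simp add: S_def \<phi>_def)
  have "S powr q \<le> C * 2 powr (1/q) / (2 * pi)"
  proof (cases "S = 0")
    case True
    then show ?thesis using C0 by simp
  next
    case False
    with S0 have S: "0 < S" by simp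
    then have r: "norm z0 < R" using z0 by (cases "norm z0 = R") (auto simp: S_def \<phi>_def)
    define d where "d = (R - norm z0) / 2"
    define \<rho> where "\<rho> = (R + norm z0) / 2"
    have d: "0 < d" "R - \<rho> = d" "\<rho> - norm z0 = d" "R - norm z0 = 2 * d"
      using r by (auto simp: d_def \<rho>_def field_simps)
    have \<rho>: "0 < \<rho>" "\<rho> < 1" "norm z0 < \<rho>" "\<rho> < R"
      using r R norm_ge_zero[of z0] unfolding \<rho>_def by (auto simp del: norm_ge_zero)
    define B where "B = S * d powr (-(1/q))"
    have B0: "0 < B" using S d by (simp add: B_def)
    have gB: "norm (g w) \<le> B" if "norm w = \<rho>" for w
    proof -
      have "norm (g w) * d powr (1/q) \<le> S"
        using max[of w] that \<rho> d by (simp add: S_def \<phi>_def)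
      then show ?thesis using d by (simp add: B_def powr_minus field_simps)
    qed
    define h where "h \<theta> = norm (g (of_real \<rho> * cis \<theta>)) powr q" for \<theta>
    have onc: "of_real \<rho> * cis \<theta> \<in> ball 0 1" for \<theta> using \<rho> by (simp add: norm_mult)
    have "continuous_on {0..2*pi} h" unfolding h_def
      using onc q by (intro continuous_intros continuous_on_powr' continuous_on_compose2[OF contg]) auto
    then have int: "(h has_integral integral {0..2*pi} h) {0..2*pi}"
      by (intro integrable_integral integrable_continuous_real)
    have "ennreal (integral {0..2*pi} h) = (\<integral>\<^sup>+\<theta>. ennreal (indicator {0..2*pi} \<theta> * h \<theta>) \<partial>lborel)"
      by (rule nn_integral_has_integral_lebesgue[OF _ int, symmetric]) (simp add: h_def)
    also have "\<dots> = (\<integral>\<^sup>+\<theta>\<in>{0..2*pi}. ennreal (norm (g (of_real \<rho> * cis \<theta>)) powr q) \<partial>lborel)"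
      by (intro nn_integral_cong) (simp add: h_def indicator_def)
    also have "\<dots> \<le> ennreal C" using C \<rho> by simp
    finally have intC: "integral {0..2*pi} h \<le> C" using C0 by (simp add: ennreal_le_iff)
    have "((\<lambda>u. g u / (u - z0)) has_contour_integral (2 * of_real pi * \<i> * g z0)) (circlepath 0 \<rho>)"
      using hol \<rho> by (intro Cauchy_integral_circlepath_simple) (auto elim!: holomorphic_on_subset)
    then have ci: "((\<lambda>t. g (of_real \<rho> * cis t) / (of_real \<rho> * cis t - z0) * of_real \<rho> * \<i> * cis t)
        has_integral (2 * of_real pi * \<i> * g z0)) {0..2*pi}"
      unfolding circlepath_def by (subst (asm) has_contour_integral_part_circlepath_iff) simp_all
    have bd: "norm (g (of_real \<rho> * cis t) / (of_real \<rho> * cis t - z0) * of_real \<rho> * \<i> * cis t)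
        \<le> B powr (1 - q) / d * h t" for t
    proof -
      let ?w = "of_real \<rho> * cis t"
      have nw: "norm ?w = \<rho>" using \<rho> by (simp add: norm_mult)
      have dist: "d \<le> norm (?w - z0)" using norm_triangle_ineq2[of ?w z0] nw d by simp
      have "norm (g ?w) = norm (g ?w) powr (1 - q) * norm (g ?w) powr q"
        by (cases "g ?w = 0") (simp_all flip: powr_add)
      also have "\<dots> \<le> B powr (1 - q) * h t"
        unfolding h_def using gB[OF nw] q by (intro mult_right_mono powr_mono2) simp_all
      finally have 1: "norm (g ?w) \<le> B powr (1 - q) * h t" .
      have "norm (g ?w / (?w - z0) * of_real \<rho> * \<i> * cis t) = norm (g ?w) * \<rho> / norm (?w - z0)"
        using \<rho> by (simp add: norm_mult norm_divide)
      also have "\<dots> \<le> (B powr (1 - q) * h t) * 1 / d"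
        using 1 \<rho> d dist by (intro frac_le mult_mono) (auto simp: h_def)
      finally show ?thesis by simp
    qed
    have "norm (2 * of_real pi * \<i> * g z0) \<le> integral {0..2*pi} (\<lambda>t. B powr (1 - q) / d * h t)"
      unfolding integral_unique[OF ci, symmetric]
      by (rule integral_norm_bound_integral[OF has_integral_integrable[OF ci]
            has_integral_integrable[OF has_integral_mult_right[OF int]] bd])
    also have "\<dots> \<le> B powr (1 - q) / d * C"
      using intC B0 d by (simp add: mult_left_mono divide_right_mono)
    finally have "2 * pi * norm (g z0) \<le> B powr (1 - q) / d * C" by (simp add: norm_mult)
    moreover have "norm (g z0) = S * (2 * d) powr (-(1/q))"
      using d r by (simp add: S_def \<phi>_def powr_minus)
    ultimately have "2 * pi * (S * (2 * d) powr (-(1/q))) \<le> B powr (1 - q) / d * C" by simp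
    also have "B powr (1 - q) / d = S powr (1 - q) * d powr (-(1/q))"
    proof -
      have "B powr (1 - q) = S powr (1 - q) * d powr (-(1/q) * (1 - q))"
        using S by (simp add: B_def powr_mult powr_powr)
      also have "-(1/q) * (1 - q) = -(1/q) + 1" using q by (simp add: field_simps)
      finally show ?thesis using d by (simp add: powr_diff powr_minus_divide)
    qed
    also have "(2 * d) powr (-(1/q)) = 2 powr (-(1/q)) * d powr (-(1/q))"
      using d by (simp add: powr_mult)
    finally have "(2 * pi * S * 2 powr (-(1/q))) * d powr (-(1/q)) \<le> (S powr (1 - q) * C) * d powr (-(1/q))"
      by (simp add: algebra_simps)
    then have bound: "2 * pi * S * 2 powr (-(1/q)) \<le> S powr (1 - q) * C"
      using d by simp
    have "S powr q * S powr (1 - q) = S" using S by (simp flip: powr_add)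
    then have factor: "(2 * pi * S powr q * 2 powr (-(1/q))) * S powr (1 - q) = 2 * pi * S * 2 powr (-(1/q))"
      by (metis mult.assoc mult.commute)
    have "(2 * pi * S powr q * 2 powr (-(1/q))) * S powr (1 - q) \<le> C * S powr (1 - q)"
      using bound unfolding factor by (simp only: mult.commute)
    then have "2 * pi * S powr q * 2 powr (-(1/q)) \<le> C" using S by simp
    then show ?thesis by (simp add: powr_minus field_simps)
  qed
  moreover have "norm (g z) powr q * (R - norm z) \<le> S powr q"
  proof -
    have "norm (g z) powr q * (R - norm z) = \<phi> z powr q"
      using R q by (simp add: \<phi>_def powr_mult powr_powr)
    also have "\<dots> \<le> S powr q" using max[of z] R q by (intro powr_mono2) (auto simp: S_def \<phi>_def)
    finally show ?thesis .
  qed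
  moreover have "R - norm z = (1 - norm z) / 2" by (simp add: R_def field_simps)
  ultimately have "norm (g z) powr q * ((1 - norm z) / 2) \<le> C * 2 powr (1/q) / (2 * pi)"
    by (metis order_trans)
  then show ?thesis by (simp add: field_simps)
qed

text \<open>Finiteness of the Hardy quasi-norm of a complex-valued function, as a real bound on the \<open>p\<close>-th
  powers of the circle means; for \<open>p < 1\<close> these are easier to add than their \<open>1/p\<close>-th powers.\<close>

definition Hardy_bounded :: "real \<Rightarrow> (complex \<Rightarrow> complex) \<Rightarrow> bool" where
  "Hardy_bounded p u \<longleftrightarrow> (\<exists>C\<ge>0. \<forall>r\<in>{0<..<1}.
     (\<integral>\<^sup>+\<theta>\<in>{0..2*pi}. ennreal (norm (u (of_real r * cis \<theta>)) powr p) \<partial>lborel) \<le> ennreal C)"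

text \<open>The case of an arbitrary exponent reduces to an exponent below 1, since \<open>|g| powr p\<close> is
  \<open>|g ^ N| powr (p/N)\<close> and \<open>g ^ N\<close> is again holomorphic.\<close>

lemma Hardy_growth:
  fixes g :: "complex \<Rightarrow> complex"
  assumes hol: "g holomorphic_on ball 0 1" and p: "0 < p" and hb: "Hardy_bounded p g"
  obtains K where "0 \<le> K" "\<And>z. norm z < 1 \<Longrightarrow> norm (g z) powr p * (1 - norm z) \<le> K"
proof -
  obtain C where C: "0 \<le> C" "\<And>r. 0 < r \<Longrightarrow> r < 1 \<Longrightarrow>
      (\<integral>\<^sup>+\<theta>\<in>{0..2*pi}. ennreal (norm (g (of_real r * cis \<theta>)) powr p) \<partial>lborel) \<le> ennreal C"
    using hb unfolding Hardy_bounded_def by auto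
  obtain N :: nat where N: "p < N" using reals_Archimedean2 by blast
  have N0: "0 < N" using N p by (cases N) auto
  have eq: "norm (g z ^ N) powr (p / N) = norm (g z) powr p" for z
  proof (cases "g z = 0")
    case False
    then show ?thesis using N0 by (simp add: norm_power powr_realpow[symmetric] powr_powr)
  qed (use N0 in simp)
  show thesis
  proof (rule that)
    fix z :: complex assume z: "norm z < 1"
    show "norm (g z) powr p * (1 - norm z) \<le> C * 2 powr (1/(p/N)) / pi"
      using Hardy_growth_lt_1[of "\<lambda>z. g z ^ N" "p/N" C z] hol p N N0 C z
      by (simp add: eq holomorphic_on_power del: divide_divide_eq_right)
  qed (use C in simp)
qed

text \<open>For exponents above \<open>p\<close>, split \<open>|g| powr m = |g| powr p * |g| powr (m - p)\<close> and estimate the second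
  factor by the growth bound: what remains is \<open>|g| powr p\<close> against the radial weight
  \<open>(1 - |z|) powr (- s)\<close> with \<open>s = (m - p)/p\<close>, and this weight is integrable over the disk exactly
  because \<open>m < 2 p\<close>.\<close>

lemma Hardy_bounded_holomorphic_integral_finite:
  fixes g :: "complex \<Rightarrow> complex"
  assumes hol: "g holomorphic_on ball 0 1" and p: "0 < p" and hb: "Hardy_bounded p g"
    and m: "0 < m" "m < 2 * p"
  shows "(\<integral>\<^sup>+z\<in>ball 0 1. ennreal (norm (g z) powr m) \<partial>lborel) < \<infinity>"
proof -
  obtain K where K: "0 \<le> K" "\<And>z. norm z < 1 \<Longrightarrow> norm (g z) powr p * (1 - norm z) \<le> K"
    using Hardy_growth[OF hol p hb] by blast
  obtain C where C: "0 \<le> C" "\<And>r. 0 < r \<Longrightarrow> r < 1 \<Longrightarrow>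
      (\<integral>\<^sup>+\<theta>\<in>{0..2*pi}. ennreal (norm (g (of_real r * cis \<theta>)) powr p) \<partial>lborel) \<le> ennreal C"
    using hb unfolding Hardy_bounded_def by auto
  \<comment> \<open>Since \<open>x powr m \<le> 1 + x powr M\<close>, small \<open>m\<close> may be replaced by an exponent strictly between \<open>p\<close> and \<open>2 p\<close>.\<close>
  define M where "M = max m (3/2 * p)"
  have M: "m \<le> M" "p < M" "M < 2 * p" using m p by (auto simp: M_def)
  define s where "s = (M - p) / p"
  have s: "0 < s" "s < 1" using M p by (auto simp: s_def field_simps)
  define F where "F z = norm (indicator (ball 0 1) z *\<^sub>R g z) powr p" for z
  define w where "w x = ennreal ((1 - x) powr (- s))" for x :: real
  have "(\<lambda>z. indicator (ball 0 1) z *\<^sub>R g z) \<in> borel_measurable borel"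
    using hol by (intro borel_measurable_continuous_on_indicator holomorphic_on_imp_continuous_on) auto
  then have [measurable]: "F \<in> borel_measurable borel" unfolding F_def by measurable
  have [measurable]: "w \<in> borel_measurable borel" unfolding w_def by measurable
  have [measurable]: "ball 0 1 \<in> sets (borel :: complex measure)" by simp
  have wfin: "(\<integral>\<^sup>+z\<in>ball 0 1. w (norm (z::complex)) \<partial>lborel) < \<infinity>"
    unfolding w_def by (rule nn_integral_ball_powr_finite[OF s])
  have "(\<integral>\<^sup>+z\<in>ball 0 1. w (norm z) * ennreal (F z) \<partial>lborel) * ennreal (2 * pi)
      \<le> 2 * ennreal C * (\<integral>\<^sup>+z\<in>ball 0 1. w (norm (z::complex)) \<partial>lborel)"
  proof (rule nn_integral_radial_weight_le)
    fix r :: real assume r: "0 < r" "r < 1"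
    then show "(\<integral>\<^sup>+\<theta>\<in>{0..2*pi}. ennreal (F (of_real r * cis \<theta>)) \<partial>lborel) \<le> ennreal C"
      using C(2)[OF r] by (simp add: F_def indicator_def norm_mult)
  qed simp_all
  also have "\<dots> < \<infinity>" using wfin by (simp add: ennreal_mult_less_top)
  finally have wF: "(\<integral>\<^sup>+z\<in>ball 0 1. w (norm z) * ennreal (F z) \<partial>lborel) < \<infinity>"
    by (auto simp: ennreal_mult_less_top)
  have pt: "norm (g z) powr m \<le> 1 + K powr s * ((1 - norm z) powr (- s) * norm (g z) powr p)"
    if z: "norm z < 1" for z
  proof -
    have "norm (g z) powr m \<le> 1 + norm (g z) powr M"
    proof (cases "norm (g z) \<le> 1")
      case True
      then have "norm (g z) powr m \<le> 1" using m by (intro powr_le1) simp_all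
      then show ?thesis by (simp add: add_increasing2)
    next
      case False
      then have "norm (g z) powr m \<le> norm (g z) powr M" using M by (intro powr_mono) simp_all
      then show ?thesis by simp
    qed
    also have "norm (g z) powr M = (norm (g z) powr p) powr s * norm (g z) powr p"
      using p by (simp add: powr_powr s_def flip: powr_add)
    also have "(norm (g z) powr p) powr s \<le> (K / (1 - norm z)) powr s"
      using K(2)[OF z] z s by (intro powr_mono2) (auto simp: field_simps)
    also have "\<dots> = K powr s * (1 - norm z) powr (- s)"
      using z K by (simp add: powr_divide powr_minus_divide)
    finally show ?thesis by (simp add: mult_right_mono mult.assoc)
  qed
  have "(\<integral>\<^sup>+z\<in>ball 0 1. ennreal (norm (g z) powr m) \<partial>lborel)
      \<le> (\<integral>\<^sup>+z. indicator (ball 0 1) z + ennreal (K powr s) * (w (norm z) * ennreal (F z) * indicator (ball 0 1) z) \<partial>lborel)"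
  proof (rule nn_integral_mono)
    fix z :: complex
    show "ennreal (norm (g z) powr m) * indicator (ball 0 1) z
      \<le> indicator (ball 0 1) z + ennreal (K powr s) * (w (norm z) * ennreal (F z) * indicator (ball 0 1) z)"
      using ennreal_leI[OF pt[of z]]
      by (cases "z \<in> ball 0 1") (simp_all add: w_def F_def ennreal_mult ennreal_plus)
  qed
  also have "\<dots> = emeasure lborel (ball (0::complex) 1)
      + ennreal (K powr s) * (\<integral>\<^sup>+z\<in>ball 0 1. w (norm z) * ennreal (F z) \<partial>lborel)"
    by (simp add: nn_integral_add nn_integral_cmult)
  also have "\<dots> < \<infinity>" using wF by (simp add: ennreal_mult_less_top emeasure_ball)
  finally show ?thesis .
qed

section \<open>Sums of functions with integrable powers\<close>

text \<open>A form of quasi-subadditivity that holds for \<open>p < 1\<close> and \<open>p \<ge> 1\<close> alike: the sum is at most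
  \<open>card A\<close> times its largest term.\<close>

lemma powr_sum_le:
  fixes a :: "'i \<Rightarrow> real"
  assumes "finite A" "0 < p" and a: "\<And>k. k \<in> A \<Longrightarrow> 0 \<le> a k"
  shows "(\<Sum>k\<in>A. a k) powr p \<le> card A powr p * (\<Sum>k\<in>A. a k powr p)"
proof (cases "A = {}")
  case False
  define b where "b = Max (a ` A)"
  have "b \<in> a ` A" unfolding b_def using assms False by (intro Max_in) auto
  then obtain j where j: "j \<in> A" "b = a j" by blast
  have le: "a k \<le> b" if "k \<in> A" for k using assms that by (simp add: b_def)
  have "(\<Sum>k\<in>A. a k) powr p \<le> (card A * b) powr p"
    using sum_bounded_above[of A a b] le assms by (intro powr_mono2 sum_nonneg) auto
  also have "\<dots> = card A powr p * a j powr p" using a j by (simp add: powr_mult)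
  also have "\<dots> \<le> card A powr p * (\<Sum>k\<in>A. a k powr p)"
    using j assms by (intro mult_left_mono member_le_sum) auto
  finally show ?thesis .
qed simp

lemma nn_integral_powr_sum_le:
  fixes v :: "'i \<Rightarrow> 'a \<Rightarrow> real"
  assumes A: "finite A" and p: "0 < p"
    and meas: "\<And>k. k \<in> A \<Longrightarrow> (\<lambda>x. ennreal (v k x powr p) * indicator X x) \<in> borel_measurable M"
    and v: "\<And>k x. k \<in> A \<Longrightarrow> x \<in> X \<Longrightarrow> 0 \<le> v k x"
    and g: "\<And>x. x \<in> X \<Longrightarrow> 0 \<le> g x" "\<And>x. x \<in> X \<Longrightarrow> g x \<le> (\<Sum>k\<in>A. v k x)"
  shows "(\<integral>\<^sup>+x\<in>X. ennreal (g x powr p) \<partial>M)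
    \<le> ennreal (card A powr p) * (\<Sum>k\<in>A. \<integral>\<^sup>+x\<in>X. ennreal (v k x powr p) \<partial>M)"
proof -
  have "(\<integral>\<^sup>+x\<in>X. ennreal (g x powr p) \<partial>M)
      \<le> (\<integral>\<^sup>+x. ennreal (card A powr p) * (\<Sum>k\<in>A. ennreal (v k x powr p) * indicator X x) \<partial>M)"
  proof (rule nn_integral_mono)
    fix x
    show "ennreal (g x powr p) * indicator X x
      \<le> ennreal (card A powr p) * (\<Sum>k\<in>A. ennreal (v k x powr p) * indicator X x)"
    proof (cases "x \<in> X")
      case True
      have "g x powr p \<le> (\<Sum>k\<in>A. v k x) powr p" using g True p by (intro powr_mono2) auto
      also have "\<dots> \<le> card A powr p * (\<Sum>k\<in>A. v k x powr p)"
        using A p v True by (intro powr_sum_le) auto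
      finally have "ennreal (g x powr p) \<le> ennreal (card A powr p * (\<Sum>k\<in>A. v k x powr p))"
        by (rule ennreal_leI)
      then show ?thesis using True by (simp add: ennreal_mult sum_nonneg sum_ennreal)
    qed simp
  qed
  also have "\<dots> = ennreal (card A powr p) * (\<Sum>k\<in>A. \<integral>\<^sup>+x\<in>X. ennreal (v k x powr p) \<partial>M)"
    using meas by (simp add: nn_integral_cmult nn_integral_sum)
  finally show ?thesis .
qed

lemma borel_measurable_norm_powr_on_ball:
  fixes u :: "complex \<Rightarrow> 'b::real_normed_vector"
  assumes u: "continuous_on (ball 0 1) u"
  shows "(\<lambda>z. ennreal (norm (u z) powr m) * indicator (ball 0 1) z) \<in> borel_measurable borel"
proof -
  have [measurable]: "ball 0 1 \<in> sets (borel :: complex measure)" by simp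
  have "(\<lambda>z. indicator (ball 0 1) z *\<^sub>R norm (u z)) \<in> borel_measurable borel"
    using u by (intro borel_measurable_continuous_on_indicator continuous_intros) auto
  then have "(\<lambda>z. ennreal ((indicator (ball 0 1) z *\<^sub>R norm (u z)) powr m) * indicator (ball 0 1) z)
      \<in> borel_measurable borel"
    by measurable
  also have "(\<lambda>z. ennreal ((indicator (ball 0 1) z *\<^sub>R norm (u z)) powr m) * indicator (ball 0 1) z)
      = (\<lambda>z. ennreal (norm (u z) powr m) * indicator (ball 0 1) z)"
    by (auto simp: indicator_def)
  finally show ?thesis .
qed

lemma borel_measurable_norm_powr_on_circle:
  fixes u :: "complex \<Rightarrow> 'b::real_normed_vector"
  assumes u: "continuous_on (ball 0 1) u" and r: "0 < r" "r < 1"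
  shows "(\<lambda>\<theta>. ennreal (norm (u (of_real r * cis \<theta>)) powr p) * indicator {0..2*pi} \<theta>)
    \<in> borel_measurable borel"
proof -
  have "(\<lambda>\<theta>. norm (u (of_real r * cis \<theta>))) \<in> borel_measurable borel"
    using r by (intro borel_measurable_continuous_onI continuous_intros continuous_on_compose2[OF u])
      (auto simp: norm_mult)
  then show ?thesis by measurable
qed

lemma Hardy_bounded_sum:
  fixes v :: "'i \<Rightarrow> complex \<Rightarrow> complex"
  assumes A: "finite A" and p: "0 < p"
    and hb: "\<And>k. k \<in> A \<Longrightarrow> Hardy_bounded p (v k)"
    and cont: "\<And>k. k \<in> A \<Longrightarrow> continuous_on (ball 0 1) (v k)"
    and g: "\<And>z. norm z < 1 \<Longrightarrow> norm (g z) \<le> (\<Sum>k\<in>A. norm (v k z))"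
  shows "Hardy_bounded p g"
proof -
  from hb obtain C where C: "\<And>k. k \<in> A \<Longrightarrow> 0 \<le> C k"
    "\<And>k r. k \<in> A \<Longrightarrow> 0 < r \<Longrightarrow> r < 1 \<Longrightarrow>
      (\<integral>\<^sup>+\<theta>\<in>{0..2*pi}. ennreal (norm (v k (of_real r * cis \<theta>)) powr p) \<partial>lborel) \<le> ennreal (C k)"
    unfolding Hardy_bounded_def by (metis greaterThanLessThan_iff)
  have "(\<integral>\<^sup>+\<theta>\<in>{0..2*pi}. ennreal (norm (g (of_real r * cis \<theta>)) powr p) \<partial>lborel)
      \<le> ennreal (card A powr p * (\<Sum>k\<in>A. C k))" if r: "0 < r" "r < 1" for r
  proof -
    have meas: "(\<lambda>\<theta>. ennreal (norm (v k (of_real r * cis \<theta>)) powr p) * indicator {0..2*pi} \<theta>)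
        \<in> borel_measurable lborel" if "k \<in> A" for k
      using borel_measurable_norm_powr_on_circle[OF cont[OF that] r] by simp
    have "(\<integral>\<^sup>+\<theta>\<in>{0..2*pi}. ennreal (norm (g (of_real r * cis \<theta>)) powr p) \<partial>lborel)
        \<le> ennreal (card A powr p) *
          (\<Sum>k\<in>A. \<integral>\<^sup>+\<theta>\<in>{0..2*pi}. ennreal (norm (v k (of_real r * cis \<theta>)) powr p) \<partial>lborel)"
      using r g by (intro nn_integral_powr_sum_le A p meas) (auto simp: norm_mult)
    also have "\<dots> \<le> ennreal (card A powr p) * (\<Sum>k\<in>A. ennreal (C k))"
      using C(2) r by (intro mult_left_mono sum_mono) auto
    also have "\<dots> = ennreal (card A powr p * (\<Sum>k\<in>A. C k))"
      using C(1) by (simp add: sum_ennreal ennreal_mult sum_nonneg)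
    finally show ?thesis .
  qed
  then show ?thesis unfolding Hardy_bounded_def
    using C(1) by (intro exI[of _ "card A powr p * (\<Sum>k\<in>A. C k)"]) (auto intro!: sum_nonneg mult_nonneg_nonneg)
qed

section \<open>Chains of Wirtinger derivatives\<close>

lemma has_derivative_cnj_power:
  "((\<lambda>z. (- cnj z) ^ k / fact k) has_derivative
     (\<lambda>h. (case k of 0 \<Rightarrow> 0 | Suc j \<Rightarrow> - ((- cnj z) ^ j / fact j)) * cnj h)) (at z)"
proof (cases k)
  case (Suc j)
  have 1: "((\<lambda>z. - cnj z) has_derivative (\<lambda>h. - cnj h)) (at z)"
    by (intro derivative_intros)
  have "((\<lambda>w::complex. w ^ Suc j / fact (Suc j)) has_field_derivative
      of_nat (Suc j) * (- cnj z) ^ j / fact (Suc j)) (at (- cnj z))"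
    using DERIV_cdivide[OF DERIV_power[OF DERIV_ident, where n = "Suc j" and x = "- cnj z" and s = UNIV], of "fact (Suc j)"]
    by (simp del: of_nat_Suc fact_Suc power_Suc)
  moreover have "of_nat (Suc j) * (- cnj z) ^ j / fact (Suc j) = (- cnj z) ^ j / fact j"
    by (simp add: divide_simps del: of_nat_Suc)
  ultimately have "((\<lambda>w::complex. w ^ Suc j / fact (Suc j)) has_derivative
      (\<lambda>h. (- cnj z) ^ j / fact j * h)) (at (- cnj z))"
    by (simp only: has_field_derivative_def)
  from has_derivative_compose[OF 1 this] show ?thesis by (simp add: Suc)
qed simp

text \<open>Reduction of a polyanalytic function \<open>u 0\<close>, with \<open>u k\<close> its \<open>k\<close>-th derivative with respect to
  \<open>cnj z\<close>, to the holomorphic case. In the Taylor-type sum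
  \<open>g = (\<Sum>k<n. (- cnj z) ^ k / fact k * u k)\<close> the derivative with respect to \<open>cnj z\<close> telescopes to a
  multiple of \<open>u n = 0\<close>, so \<open>g\<close> is holomorphic. Its coefficients are bounded by 1 on the disk, so \<open>g\<close>
  inherits the Hardy bound and is covered by the holomorphic case. The functions \<open>u k\<close> with
  \<open>k > 0\<close> start shorter chains and are covered by induction; hence so is
  \<open>u 0\<close>, which is \<open>g\<close> minus the terms with \<open>k > 0\<close>.\<close>

lemma Wirtinger_chain_integral_finite:
  fixes u :: "nat \<Rightarrow> complex \<Rightarrow> complex"
  assumes p: "0 < p" and m: "0 < m" "m < 2 * p"
    and deriv: "\<And>k z. k < n \<Longrightarrow> norm z < 1 \<Longrightarrow>
      \<exists>a. (u k has_derivative (\<lambda>h. a * h + u (Suc k) z * cnj h)) (at z)"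
    and zero: "\<And>z. norm z < 1 \<Longrightarrow> u n z = 0"
    and hb: "\<And>k. k < n \<Longrightarrow> Hardy_bounded p (u k)"
  shows "(\<integral>\<^sup>+z\<in>ball 0 1. ennreal (norm (u 0 z) powr m) \<partial>lborel) < \<infinity>"
  using deriv zero hb
proof (induction n arbitrary: u rule: less_induct)
  case (less n)
  note deriv = less.prems(1) and zero = less.prems(2) and hb = less.prems(3)
  show ?case
  proof (cases "n = 0")
    case True
    have "(\<integral>\<^sup>+z\<in>ball 0 1. ennreal (norm (u 0 z) powr m) \<partial>lborel) = (\<integral>\<^sup>+z. 0 \<partial>(lborel :: complex measure))"
      using zero True by (intro nn_integral_cong) (auto simp: indicator_def)
    then show ?thesis by simp
  next
    case False
    have cont: "continuous_on (ball 0 1) (u k)" if "k < n" for k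
    proof (rule continuous_at_imp_continuous_on, rule ballI)
      fix z :: complex assume "z \<in> ball 0 1"
      then show "isCont (u k) z" using deriv[OF that, of z] has_derivative_continuous by auto
    qed
    have tail: "(\<integral>\<^sup>+z\<in>ball 0 1. ennreal (norm (u k z) powr m) \<partial>lborel) < \<infinity>"
      if k: "0 < k" "k < n" for k
    proof -
      have "(\<integral>\<^sup>+z\<in>ball 0 1. ennreal (norm ((\<lambda>i. u (i + k)) 0 z) powr m) \<partial>lborel) < \<infinity>"
      proof (rule less.IH[of "n - k"])
        show "\<exists>a. (u (i + k) has_derivative (\<lambda>h. a * h + u (Suc i + k) z * cnj h)) (at z)"
          if "i < n - k" "norm z < 1" for i z using deriv[of "i + k" z] that by simp
      qed (use k zero hb in auto)
      then show ?thesis by simp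
    qed
    define c where "c k z = (- cnj z) ^ k / fact k" for k :: nat and z
    define g where "g z = (\<Sum>k<n. c k z * u k z)" for z
    have norm_c: "norm (c k z) \<le> 1" if "norm z < 1" for k z
    proof -
      have "norm (c k z) \<le> 1 / 1" unfolding c_def norm_divide norm_power
        using that by (intro frac_le) (auto simp: power_le_one fact_ge_1)
      then show ?thesis by simp
    qed
    have hol: "g holomorphic_on ball 0 1"
    proof (rule holomorphic_onI)
      fix z :: complex assume "z \<in> ball 0 1"
      then have z: "norm z < 1" by simp
      obtain a where a: "\<And>k. k < n \<Longrightarrow> (u k has_derivative (\<lambda>h. a k * h + u (Suc k) z * cnj h)) (at z)"
      proof -
        have "\<forall>k. \<exists>a. k < n \<longrightarrow> (u k has_derivative (\<lambda>h. a * h + u (Suc k) z * cnj h)) (at z)"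
          using deriv z by blast
        from choice[OF this] show thesis using that by blast
      qed
      define d where "d k = (case k of 0 \<Rightarrow> 0 | Suc j \<Rightarrow> - c j z)" for k
      have dc: "(c k has_derivative (\<lambda>h. d k * cnj h)) (at z)" for k
        using has_derivative_cnj_power[of k z] unfolding c_def d_def .
      have "(g has_derivative (\<lambda>h. \<Sum>k<n. c k z * (a k * h + u (Suc k) z * cnj h) + d k * cnj h * u k z)) (at z)"
        unfolding g_def by (intro has_derivative_sum has_derivative_mult a dc) simp
      also have "(\<lambda>h. \<Sum>k<n. c k z * (a k * h + u (Suc k) z * cnj h) + d k * cnj h * u k z)
          = (*) (\<Sum>k<n. c k z * a k)"
      proof
        fix h
        \<comment> \<open>By \<open>d (Suc k) = - c k z\<close>, the coefficient of \<open>cnj h\<close> in the \<open>k\<close>-th term is \<open>t (Suc k) - t k\<close>.\<close>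
        define t where "t k = - d k * u k z" for k
        have "(\<Sum>k<n. t (Suc k) - t k) = t n - t 0" by (rule sum_lessThan_telescope)
        also have "\<dots> = 0" using zero[OF z] by (simp add: t_def d_def)
        finally have 0: "(\<Sum>k<n. t (Suc k) - t k) = 0" .
        have "(\<Sum>k<n. c k z * (a k * h + u (Suc k) z * cnj h) + d k * cnj h * u k z)
            = (\<Sum>k<n. c k z * a k * h + (t (Suc k) - t k) * cnj h)"
          by (intro sum.cong refl) (simp add: t_def d_def algebra_simps)
        also have "\<dots> = (\<Sum>k<n. c k z * a k) * h + (\<Sum>k<n. t (Suc k) - t k) * cnj h"
          by (simp add: sum.distrib sum_distrib_right)
        finally show "(\<Sum>k<n. c k z * (a k * h + u (Suc k) z * cnj h) + d k * cnj h * u k z)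
            = (\<Sum>k<n. c k z * a k) * h" by (simp add: 0)
      qed
      finally show "g field_differentiable at z within ball 0 1"
        by (metis field_differentiable_at_within field_differentiable_def has_field_derivative_def)
    qed
    have hbg: "Hardy_bounded p g"
    proof (rule Hardy_bounded_sum[of "{..<n}" p u])
      fix z :: complex assume z: "norm z < 1"
      have "norm (g z) \<le> (\<Sum>k<n. norm (c k z * u k z))" unfolding g_def by (rule norm_sum)
      also have "\<dots> \<le> (\<Sum>k<n. norm (u k z))"
        using norm_c[OF z] by (intro sum_mono) (simp add: norm_mult mult_left_le_one_le)
      finally show "norm (g z) \<le> (\<Sum>k<n. norm (u k z))" .
    qed (use hb cont p in auto)
    define v where "v = u(0 := g)"
    have vfin: "(\<integral>\<^sup>+z\<in>ball 0 1. ennreal (norm (v k z) powr m) \<partial>lborel) < \<infinity>" if "k < n" for k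
      using tail[of k] that Hardy_bounded_holomorphic_integral_finite[OF hol p hbg m]
      by (cases "k = 0") (simp_all add: v_def)
    have vcont: "continuous_on (ball 0 1) (v k)" if "k < n" for k
      using cont[OF that] holomorphic_on_imp_continuous_on[OF hol] by (cases "k = 0") (simp_all add: v_def)
    have dom: "norm (u 0 z) \<le> (\<Sum>k<n. norm (v k z))" if z: "norm z < 1" for z
    proof -
      have split: "(\<Sum>k<n. f k) = f 0 + (\<Sum>k\<in>{1..<n}. f k)" for f :: "nat \<Rightarrow> 'b::comm_monoid_add"
        using False by (simp add: lessThan_atLeast0 sum.atLeast_Suc_lessThan)
      have "u 0 z = g z - (\<Sum>k\<in>{1..<n}. c k z * u k z)"
        unfolding g_def split by (simp add: c_def)
      then have "norm (u 0 z) \<le> norm (g z) + norm (\<Sum>k\<in>{1..<n}. c k z * u k z)"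
        by (simp only: norm_triangle_ineq4)
      also have "\<dots> \<le> norm (g z) + (\<Sum>k\<in>{1..<n}. norm (c k z * u k z))"
        by (intro add_left_mono norm_sum)
      also have "\<dots> \<le> norm (g z) + (\<Sum>k\<in>{1..<n}. norm (u k z))"
        using norm_c[OF z] by (intro add_left_mono sum_mono) (simp add: norm_mult mult_left_le_one_le)
      also have "\<dots> = (\<Sum>k<n. norm (v k z))"
        unfolding split by (simp add: v_def)
      finally show ?thesis .
    qed
    have vmeas: "(\<lambda>z. ennreal (norm (v k z) powr m) * indicator (ball 0 1) z) \<in> borel_measurable lborel"
      if "k < n" for k
      using borel_measurable_norm_powr_on_ball[OF vcont[OF that]] by simp
    have "(\<integral>\<^sup>+z\<in>ball 0 1. ennreal (norm (u 0 z) powr m) \<partial>lborel)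
        \<le> ennreal (card {..<n} powr m) * (\<Sum>k<n. \<integral>\<^sup>+z\<in>ball 0 1. ennreal (norm (v k z) powr m) \<partial>lborel)"
      using dom m vmeas by (intro nn_integral_powr_sum_le) auto
    also have "\<dots> < \<infinity>" using vfin by (auto simp: ennreal_mult_less_top)
    finally show ?thesis .
  qed
qed

section \<open>Differentiability on the disk\<close>

text \<open>The classical criterion for total differentiability. Continuity of one partial derivative is enough:
  an increment is split into a horizontal step at fixed height, where differentiability in that
  direction suffices, and a vertical step, which the mean value inequality controls.\<close>

lemma has_derivative_continuous_partials:
  fixes F :: "complex \<Rightarrow> 'b::real_normed_vector"
  assumes S: "open S" "z \<in> S"
    and dx: "\<And>w. w \<in> S \<Longrightarrow> ((\<lambda>t. F (w + of_real t)) has_vector_derivative Fx w) (at 0)"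
    and dy: "\<And>w. w \<in> S \<Longrightarrow> ((\<lambda>t. F (w + \<i> * of_real t)) has_vector_derivative Fy w) (at 0)"
    and cont: "continuous_on S Fy"
  shows "(F has_derivative (\<lambda>h. Re h *\<^sub>R Fx z + Im h *\<^sub>R Fy z)) (at z)"
proof -
  obtain e where e: "0 < e" "ball z e \<subseteq> S" using S openE by blast
  define X where "X = {Re z - e/2<..<Re z + e/2}"
  define Y where "Y = {Im z - e/2<..<Im z + e/2}"
  have zXY: "Re z \<in> X" "Im z \<in> Y" using e by (simp_all add: X_def Y_def)
  have box: "Complex x y \<in> S" if "x \<in> X" "y \<in> Y" for x y
  proof -
    have "norm (Complex x y - z) \<le> \<bar>x - Re z\<bar> + \<bar>y - Im z\<bar>"
      using cmod_le[of "Complex x y - z"] by simp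
    also have "\<dots> < e" using that by (auto simp: X_def Y_def abs_if field_simps)
    finally show ?thesis using e(2) by (auto simp: dist_norm norm_minus_commute)
  qed
  have px: "((\<lambda>x. F (Complex x y)) has_vector_derivative Fx (Complex x0 y)) (at x0)"
    if "x0 \<in> X" "y \<in> Y" for x0 y
  proof -
    have "((\<lambda>x. x - x0) has_vector_derivative 1) (at x0)"
      by (auto intro!: derivative_eq_intros)
    from vector_diff_chain_at[OF this, of "\<lambda>t. F (Complex x0 y + of_real t)"] dx[OF box[OF that]]
    have "((\<lambda>t. F (Complex x0 y + of_real t)) \<circ> (\<lambda>x. x - x0) has_vector_derivative Fx (Complex x0 y)) (at x0)"
      by simp
    moreover have "(\<lambda>t. F (Complex x0 y + of_real t)) \<circ> (\<lambda>x. x - x0) = (\<lambda>x. F (Complex x y))"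
      by (auto simp: fun_eq_iff complex_eq_iff intro!: arg_cong[of _ _ F])
    ultimately show ?thesis by simp
  qed
  have py: "((\<lambda>y. F (Complex x y)) has_vector_derivative Fy (Complex x y0)) (at y0)"
    if "x \<in> X" "y0 \<in> Y" for x y0
  proof -
    have "((\<lambda>y. y - y0) has_vector_derivative 1) (at y0)"
      by (auto intro!: derivative_eq_intros)
    from vector_diff_chain_at[OF this, of "\<lambda>t. F (Complex x y0 + \<i> * of_real t)"] dy[OF box[OF that]]
    have "((\<lambda>t. F (Complex x y0 + \<i> * of_real t)) \<circ> (\<lambda>y. y - y0) has_vector_derivative Fy (Complex x y0)) (at y0)"
      by simp
    moreover have "(\<lambda>t. F (Complex x y0 + \<i> * of_real t)) \<circ> (\<lambda>y. y - y0) = (\<lambda>y. F (Complex x y))"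
      by (auto simp: fun_eq_iff complex_eq_iff intro!: arg_cong[of _ _ F])
    ultimately show ?thesis by simp
  qed
  have "((\<lambda>(x, y). F (Complex x y)) has_derivative
      (\<lambda>(tx, ty). tx *\<^sub>R Fx z + blinfun_scaleR_left (Fy (Complex (Re z) (Im z))) ty))
      (at (Re z, Im z) within X \<times> Y)"
  proof (rule has_derivative_partialsI)
    show "((\<lambda>x. F (Complex x (Im z))) has_derivative (\<lambda>tx. tx *\<^sub>R Fx z)) (at (Re z) within X)"
      using px[OF zXY] by (auto simp: has_vector_derivative_def intro: has_derivative_at_withinI)
    show "((\<lambda>y. F (Complex x y)) has_derivative blinfun_apply (blinfun_scaleR_left (Fy (Complex x y)))) (at y within Y)"
      if "x \<in> X" "y \<in> Y" for x y
      using py[OF that] by (auto simp: has_vector_derivative_def intro: has_derivative_at_withinI)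
    have "continuous_on (X \<times> Y) (\<lambda>(x, y). Fy (Complex x y))"
      unfolding split_beta
    proof (rule continuous_on_compose2[OF cont])
      show "continuous_on (X \<times> Y) (\<lambda>p. Complex (fst p) (snd p))"
        unfolding Complex_eq by (intro continuous_intros)
    qed (auto intro: box)
    then have "continuous_on (X \<times> Y) (\<lambda>(x, y). blinfun_scaleR_left (Fy (Complex x y)))"
      unfolding split_beta by (intro bounded_linear.continuous_on[OF bounded_linear_blinfun_scaleR_left])
    then show "continuous (at (Re z, Im z) within X \<times> Y) (\<lambda>(x, y). blinfun_scaleR_left (Fy (Complex x y)))"
      using zXY by (auto simp: continuous_on_eq_continuous_within)
  qed (use zXY in \<open>auto simp: Y_def\<close>)
  moreover have "at (Re z, Im z) within X \<times> Y = at (Re z, Im z)"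
    by (rule at_within_open) (use zXY in \<open>auto simp: X_def Y_def intro!: open_Times\<close>)
  ultimately have "((\<lambda>(x, y). F (Complex x y)) has_derivative (\<lambda>(tx, ty). tx *\<^sub>R Fx z + ty *\<^sub>R Fy z)) (at (Re z, Im z))"
    by simp
  moreover have "((\<lambda>w. (Re w, Im w)) has_derivative (\<lambda>h. (Re h, Im h))) (at z)"
    by (intro derivative_intros)
  ultimately show ?thesis
    using has_derivative_compose[of "\<lambda>w. (Re w, Im w)" "\<lambda>h. (Re h, Im h)" z UNIV
        "\<lambda>(x, y). F (Complex x y)" "\<lambda>(tx, ty). tx *\<^sub>R Fx z + ty *\<^sub>R Fy z"] by simp
qed

text \<open>The two coordinate derivatives are the cases \<open>c = 1\<close> and \<open>c = \<i>\<close>; a common definition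
  lets both be treated by a single argument.\<close>

definition deriv_along :: "complex \<Rightarrow> (complex \<Rightarrow> bicomplex) \<Rightarrow> complex \<Rightarrow> bicomplex" where
  "deriv_along c f z = vector_derivative (\<lambda>t::real. f (z + c * of_real t)) (at 0)"

lemma partial_x_eq: "partial_x = deriv_along 1" and partial_y_eq: "partial_y = deriv_along \<i>"
  by (simp_all add: fun_eq_iff partial_x_def partial_y_def deriv_along_def)

lemma C_on_disk_Suc_iff:
  "C_on_disk (Suc k) f \<longleftrightarrow> continuous_on (ball 0 1) f \<and>
    (\<forall>c\<in>{1, \<i>}. (\<forall>z\<in>ball 0 1. ((\<lambda>t. f (z + c * of_real t)) has_vector_derivative deriv_along c f z) (at 0))
      \<and> C_on_disk k (deriv_along c f))"
  by (auto simp: partial_x_eq partial_y_eq deriv_along_def vector_derivative_works)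

lemma C_on_disk_SucD:
  assumes "C_on_disk (Suc k) f" "c \<in> {1, \<i>}"
  shows "C_on_disk k (deriv_along c f)"
    and "z \<in> ball 0 1 \<Longrightarrow> ((\<lambda>t. f (z + c * of_real t)) has_vector_derivative deriv_along c f z) (at 0)"
  using bspec[OF conjunct2[OF assms(1)[unfolded C_on_disk_Suc_iff]] assms(2)] by blast+

lemma C_on_disk_continuous: "C_on_disk k f \<Longrightarrow> continuous_on (ball 0 1) f"
  by (cases k) simp_all

lemma eventually_in_disk_along:
  assumes "z \<in> ball 0 1"
  shows "\<forall>\<^sub>F t in nhds 0. z + c * complex_of_real t \<in> ball 0 1"
proof -
  have "open ((\<lambda>t. z + c * complex_of_real t) -` ball 0 1)"
    by (intro open_vimage open_ball continuous_intros)
  from eventually_nhds_in_open[OF this, of 0] assms show ?thesis by simp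
qed

text \<open>The identities for derivatives below hold on the disk only, whereas the recursion in
  \<open>C_on_disk\<close> passes to partial derivatives as functions on the whole plane.\<close>

lemma C_on_disk_cong:
  assumes "C_on_disk k f" and "\<And>z. z \<in> ball 0 1 \<Longrightarrow> f z = g z"
  shows "C_on_disk k g"
  using assms
proof (induction k arbitrary: f g)
  case 0
  then show ?case using continuous_on_cong[of "ball 0 1" "ball 0 1" f g] by simp
next
  case (Suc k)
  have ev: "\<forall>\<^sub>F t in nhds 0. t \<in> UNIV \<longrightarrow> f (z + c * of_real t) = g (z + c * of_real t)" if "z \<in> ball 0 1" for z c
    using eventually_in_disk_along[OF that, of c] by eventually_elim (use Suc.prems(2) in blast)
  have d: "deriv_along c f z = deriv_along c g z" if "z \<in> ball 0 1" for z c
    unfolding deriv_along_def by (intro vector_derivative_cong_eq ev that) simp_all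
  have hd: "((\<lambda>t. f (z + c * of_real t)) has_vector_derivative v) (at 0) =
      ((\<lambda>t. g (z + c * of_real t)) has_vector_derivative v) (at 0)" if "z \<in> ball 0 1" for z c v
    using that Suc.prems(2) by (intro has_vector_derivative_cong_ev ev) auto
  show ?case
    unfolding C_on_disk_Suc_iff
  proof (intro conjI ballI)
    show "continuous_on (ball 0 1) g"
      using C_on_disk_continuous[OF Suc.prems(1)] Suc.prems(2) continuous_on_cong[of "ball 0 1" "ball 0 1" f g] by simp
    fix c assume c: "c \<in> {1, \<i>}"
    show "((\<lambda>t. g (z + c * of_real t)) has_vector_derivative deriv_along c g z) (at 0)" if "z \<in> ball 0 1" for z
      using Suc.prems(1) c that unfolding C_on_disk_Suc_iff hd[OF that, symmetric] d[OF that, symmetric] by blast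
    show "C_on_disk k (deriv_along c g)"
      by (rule Suc.IH[OF C_on_disk_SucD(1)[OF Suc.prems(1) c]]) (rule d)
  qed
qed

lemma C_on_disk_linear_combination:
  assumes "bounded_linear A" "bounded_linear B" "C_on_disk k f" "C_on_disk k g"
  shows "C_on_disk k (\<lambda>z. A (f z) + B (g z))"
  using assms(3,4)
proof (induction k arbitrary: f g)
  case 0
  then show ?case
    by (auto intro!: continuous_intros bounded_linear.continuous_on[OF assms(1)] bounded_linear.continuous_on[OF assms(2)])
next
  case (Suc k)
  let ?h = "\<lambda>z. A (f z) + B (g z)"
  have hd: "((\<lambda>t. ?h (z + c * of_real t)) has_vector_derivative A (deriv_along c f z) + B (deriv_along c g z)) (at 0)"
    if "c \<in> {1, \<i>}" "z \<in> ball 0 1" for c z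
    using Suc.prems that unfolding C_on_disk_Suc_iff
    by (intro has_vector_derivative_add bounded_linear.has_vector_derivative[OF assms(1)]
        bounded_linear.has_vector_derivative[OF assms(2)]) blast+
  then have d: "deriv_along c ?h z = A (deriv_along c f z) + B (deriv_along c g z)"
    if "c \<in> {1, \<i>}" "z \<in> ball 0 1" for c z
    using that unfolding deriv_along_def[of c ?h] by (intro vector_derivative_at)
  show ?case
    unfolding C_on_disk_Suc_iff
  proof (intro conjI ballI)
    show "continuous_on (ball 0 1) ?h"
      using Suc.prems[THEN C_on_disk_continuous]
      by (intro continuous_intros bounded_linear.continuous_on[OF assms(1)] bounded_linear.continuous_on[OF assms(2)])
    fix c assume c: "c \<in> {1, \<i>}"
    show "((\<lambda>t. ?h (z + c * of_real t)) has_vector_derivative deriv_along c ?h z) (at 0)" if "z \<in> ball 0 1" for z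
      unfolding d[OF c that] by (rule hd[OF c that])
    show "C_on_disk k (deriv_along c ?h)"
    proof (rule C_on_disk_cong)
      show "C_on_disk k (\<lambda>z. A (deriv_along c f z) + B (deriv_along c g z))"
        by (intro Suc.IH C_on_disk_SucD(1)[OF _ c] Suc.prems)
    qed (use d[OF c] in simp)
  qed
qed

section \<open>Idempotent components of bicomplex functions\<close>

lemma bc_minus_j_mult: "bc_minus (bc_j * w) = \<i> * bc_minus w"
  and bc_plus_j_mult: "bc_plus (bc_j * w) = - (\<i> * bc_plus w)"
  by (simp_all add: bc_minus_def bc_plus_def bc_j_def times_bicomplex_def algebra_simps)

lemma norm_bc_minus_le: "norm (bc_minus w) \<le> 2 * norm w"
  and norm_bc_plus_le: "norm (bc_plus w) \<le> 2 * norm w"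
proof -
  have sq: "2 * (norm w)\<^sup>2 = (norm (bc_plus w))\<^sup>2 + (norm (bc_minus w))\<^sup>2"
    by (simp add: norm_bicomplex_def)
  have four: "(2 * norm w)\<^sup>2 = 4 * (norm w)\<^sup>2" by (simp add: power_mult_distrib)
  have "(norm (bc_minus w))\<^sup>2 \<le> (2 * norm w)\<^sup>2"
    using sq four zero_le_power2[of "norm (bc_plus w)"] zero_le_power2[of "norm w"] by linarith
  moreover have "(norm (bc_plus w))\<^sup>2 \<le> (2 * norm w)\<^sup>2"
    using sq four zero_le_power2[of "norm (bc_minus w)"] zero_le_power2[of "norm w"] by linarith
  ultimately show "norm (bc_minus w) \<le> 2 * norm w" "norm (bc_plus w) \<le> 2 * norm w"
    by (auto intro: power2_le_imp_le)
qed

lemma norm_bicomplex_le: "norm w \<le> norm (bc_minus w) + norm (cnj (bc_plus w))"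
proof (rule power2_le_imp_le)
  have "(norm w)\<^sup>2 = ((norm (bc_plus w))\<^sup>2 + (norm (bc_minus w))\<^sup>2) / 2"
    by (simp add: norm_bicomplex_def)
  also have "\<dots> \<le> (norm (bc_minus w) + norm (cnj (bc_plus w)))\<^sup>2"
    using zero_le_power2[of "norm (bc_minus w)"] zero_le_power2[of "norm (bc_plus w)"]
    by (simp add: power2_sum)
  finally show "(norm w)\<^sup>2 \<le> (norm (bc_minus w) + norm (cnj (bc_plus w)))\<^sup>2" .
qed simp

lemma bounded_linear_bc_minus: "bounded_linear bc_minus"
proof (rule bounded_linear_intro[where K = 2])
  show "norm (bc_minus w) \<le> norm w * 2" for w using norm_bc_minus_le[of w] by simp
qed (simp_all add: bc_minus_def plus_bicomplex_def scaleR_bicomplex_def algebra_simps)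

lemma bounded_linear_cnj_bc_plus: "bounded_linear (\<lambda>w. cnj (bc_plus w))"
proof (rule bounded_linear_intro[where K = 2])
  show "norm (cnj (bc_plus w)) \<le> norm w * 2" for w using norm_bc_plus_le[of w] by simp
qed (simp_all add: bc_plus_def plus_bicomplex_def scaleR_bicomplex_def algebra_simps)

lemma bounded_linear_bc_j: "bounded_linear (\<lambda>w. (1/2) *\<^sub>R (bc_j * w))"
proof (rule bounded_linear_intro[where K = 1])
  show "norm ((1/2) *\<^sub>R (bc_j * w)) \<le> norm w * 1" for w
  proof -
    have "norm (bc_j * w) = norm w"
      by (simp add: norm_bicomplex_def bc_minus_j_mult bc_plus_j_mult norm_mult)
    then show ?thesis by simp
  qed
qed (simp_all add: bicomplex_eq_iff scaleR_bicomplex_def times_bicomplex_def plus_bicomplex_def algebra_simps)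

lemma C_on_disk_dbar:
  assumes "C_on_disk (Suc k) f"
  shows "C_on_disk k (dbar f)"
proof -
  have "C_on_disk k (\<lambda>z. (1/2) *\<^sub>R partial_x f z + (1/2) *\<^sub>R (bc_j * partial_y f z))"
    using assms by (intro C_on_disk_linear_combination bounded_linear_bc_j bounded_linear_scaleR_right) simp_all
  then show ?thesis by (rule C_on_disk_cong) (simp add: dbar_def scaleR_add_right)
qed

lemma C_on_disk_dbar_power:
  assumes "C_on_disk n f" "k \<le> n"
  shows "C_on_disk (n - k) ((dbar ^^ k) f)"
  using assms(2)
proof (induction k)
  case (Suc k)
  then show ?case using C_on_disk_dbar[of "n - Suc k"] by (simp add: Suc_diff_Suc)
qed (use assms in simp)

text \<open>A real-linear map \<open>L\<close> to the complex numbers with \<open>L (j w) = \<i> L w\<close> turns the bicomplex operator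
  \<open>dbar\<close> into the derivative with respect to \<open>cnj z\<close>. Both \<open>bc_minus\<close> and the conjugate of \<open>bc_plus\<close>
  are such maps; the conjugation compensates for \<open>j\<close> acting as \<open>- \<i>\<close> on \<open>bc_plus\<close>.\<close>

lemma component_has_derivative:
  assumes L: "bounded_linear L" "\<And>w. L (bc_j * w) = \<i> * L w"
    and f: "C_on_disk (Suc k) f" and z: "norm z < 1"
  shows "\<exists>a. ((\<lambda>z. L (f z)) has_derivative (\<lambda>h. a * h + L (dbar f z) * cnj h)) (at z)"
proof -
  interpret bounded_linear L by (rule L(1))
  have d: "((\<lambda>t. L (f (w + c * of_real t))) has_vector_derivative L (deriv_along c f w)) (at 0)"
    if "w \<in> ball 0 1" "c \<in> {1, \<i>}" for w c
    using C_on_disk_SucD(2)[OF f] that by (intro has_vector_derivative) blast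
  have "((\<lambda>z. L (f z)) has_derivative
      (\<lambda>h. Re h *\<^sub>R L (deriv_along 1 f z) + Im h *\<^sub>R L (deriv_along \<i> f z))) (at z)"
  proof (rule has_derivative_continuous_partials[where S = "ball 0 1"])
    show "continuous_on (ball 0 1) (\<lambda>w. L (deriv_along \<i> f w))"
      by (intro continuous_on C_on_disk_continuous[OF C_on_disk_SucD(1)[OF f]]) simp
  qed (use z d[of _ 1] d[of _ \<i>] in auto)
  moreover have "Re h *\<^sub>R L (deriv_along 1 f z) + Im h *\<^sub>R L (deriv_along \<i> f z)
      = (L (deriv_along 1 f z) - \<i> * L (deriv_along \<i> f z)) / 2 * h + L (dbar f z) * cnj h" for h
  proof -
    have dbar_eq: "L (dbar f z) = (L (deriv_along 1 f z) + \<i> * L (deriv_along \<i> f z)) / 2"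
      by (simp add: dbar_def partial_x_eq partial_y_eq scaleR add L(2) scaleR_conv_of_real)
    show ?thesis unfolding dbar_eq by (simp add: complex_eq_iff field_simps)
  qed
  ultimately show ?thesis by (intro exI) (simp only:)
qed

lemma Hardy_bounded_component:
  assumes p: "0 < p" and fin: "hardy_norm p f < \<infinity>" and f: "continuous_on (ball 0 1) f"
    and L: "\<And>w. norm (L w) \<le> 2 * norm w"
  shows "Hardy_bounded p (\<lambda>z. L (f z))"
proof -
  define I where "I r = (\<integral>\<^sup>+\<theta>\<in>{0..2*pi}. ennreal (norm (f (of_real r * cis \<theta>)) powr p) \<partial>lborel)" for r
  obtain H where H: "hardy_norm p f = ennreal H" "0 \<le> H"
    using fin by (cases "hardy_norm p f") auto
  have I: "I r \<le> ennreal (H powr p)" if r: "0 < r" "r < 1" for r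
  proof -
    have le: "ennreal_powr (I r) (1/p) \<le> ennreal H"
      unfolding H(1)[symmetric] hardy_norm_def I_def using r by (intro SUP_upper) simp
    then have "I r \<noteq> \<infinity>" by (auto simp: ennreal_powr_def top_unique)
    then obtain J where J: "I r = ennreal J" "0 \<le> J" by (cases "I r") auto
    then have "J powr (1/p) \<le> H" using le H by (simp add: ennreal_powr_def)
    then have "(J powr (1/p)) powr p \<le> H powr p" using p by (intro powr_mono2) simp_all
    then show ?thesis using J p by (simp add: powr_powr ennreal_leI)
  qed
  have "(\<integral>\<^sup>+\<theta>\<in>{0..2*pi}. ennreal (norm (L (f (of_real r * cis \<theta>))) powr p) \<partial>lborel)
      \<le> ennreal (2 powr p * (2 * H powr p))" if r: "0 < r" "r < 1" for r
  proof -
    \<comment> \<open>The factor 2 in the bound on \<open>L\<close> is read as a sum of two equal terms, indexed by \<open>bool\<close>.\<close>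
    have "(\<integral>\<^sup>+\<theta>\<in>{0..2*pi}. ennreal (norm (L (f (of_real r * cis \<theta>))) powr p) \<partial>lborel)
        \<le> ennreal (card (UNIV :: bool set) powr p) * (\<Sum>b\<in>(UNIV :: bool set). I r)"
      unfolding I_def using p L borel_measurable_norm_powr_on_circle[OF f r]
      by (intro nn_integral_powr_sum_le) auto
    also have "\<dots> = ennreal (2 powr p) * (2 * I r)" by (simp add: UNIV_bool card_insert_if)
    also have "\<dots> \<le> ennreal (2 powr p) * (2 * ennreal (H powr p))"
      using I[OF r] by (intro mult_left_mono) simp_all
    also have "\<dots> = ennreal (2 powr p * (2 * H powr p))"
      by (simp add: ennreal_mult)
    finally show ?thesis .
  qed
  then show ?thesis unfolding Hardy_bounded_def by (intro exI[of _ "2 powr p * (2 * H powr p)"]) auto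
qed

section \<open>Integrability of bicomplex polyanalytic functions\<close>

theorem proposition5p5:
  fixes p m :: real and n :: nat and f :: "complex \<Rightarrow> bicomplex"
  assumes "0 < p" and "0 < n"
    and "f \<in> P_hardy_space n p"
    and "0 < m" and "m < 2 * p"
  shows "f \<in> L_space m"
proof -
  have C: "C_on_disk n f" and zero: "\<And>z. norm z < 1 \<Longrightarrow> (dbar ^^ n) f z = 0"
    and fin: "(\<Sum>k<n. hardy_norm p ((dbar ^^ k) f)) < \<infinity>"
    using assms(3) by (auto simp: P_hardy_space_def P_space_def)
  have hn: "hardy_norm p ((dbar ^^ k) f) < \<infinity>" if "k < n" for k
    using fin that by (auto simp: less_top)
  have Ck: "C_on_disk (Suc (n - Suc k)) ((dbar ^^ k) f)" if "k < n" for k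
    using C_on_disk_dbar_power[OF C, of k] that by (simp add: Suc_diff_Suc)
  have contf: "continuous_on (ball 0 1) f" using C by (rule C_on_disk_continuous)
  have component: "(\<integral>\<^sup>+z\<in>ball 0 1. ennreal (norm (L (f z)) powr m) \<partial>lborel) < \<infinity>"
    if L: "bounded_linear L" "\<And>w. L (bc_j * w) = \<i> * L w" "\<And>w. norm (L w) \<le> 2 * norm w"
    for L :: "bicomplex \<Rightarrow> complex"
  proof -
    have "(\<integral>\<^sup>+z\<in>ball 0 1. ennreal (norm ((\<lambda>k z. L ((dbar ^^ k) f z)) 0 z) powr m) \<partial>lborel) < \<infinity>"
    proof (rule Wirtinger_chain_integral_finite[OF assms(1,4,5)])
      show "\<exists>a. ((\<lambda>z. L ((dbar ^^ k) f z)) has_derivative (\<lambda>h. a * h + L ((dbar ^^ Suc k) f z) * cnj h)) (at z)"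
        if "k < n" "norm z < 1" for k z
        using component_has_derivative[OF L(1,2) Ck[OF that(1)] that(2)] by simp
      show "L ((dbar ^^ n) f z) = 0" if "norm z < 1" for z
        using zero[OF that] linear_0[OF bounded_linear.linear[OF L(1)]] by simp
      show "Hardy_bounded p (\<lambda>z. L ((dbar ^^ k) f z))" if "k < n" for k
        using Hardy_bounded_component[OF assms(1) hn[OF that] C_on_disk_continuous[OF Ck[OF that]] L(3)] .
    qed
    then show ?thesis by simp
  qed
  \<comment> \<open>The two components, indexed by \<open>bool\<close>; together they dominate \<open>norm (f z)\<close>.\<close>
  define v where "v b z = norm (if b then bc_minus (f z) else cnj (bc_plus (f z)))" for b z
  have vfin: "(\<integral>\<^sup>+z\<in>ball 0 1. ennreal (v b z powr m) \<partial>lborel) < \<infinity>" for b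
    using component[OF bounded_linear_bc_minus] component[OF bounded_linear_cnj_bc_plus]
    by (cases b) (simp_all add: v_def bc_minus_j_mult bc_plus_j_mult norm_bc_minus_le norm_bc_plus_le)
  have vmeas: "(\<lambda>z. ennreal (v b z powr m) * indicator (ball 0 1) z) \<in> borel_measurable lborel" for b
    using borel_measurable_norm_powr_on_ball[OF bounded_linear.continuous_on[OF bounded_linear_bc_minus contf]]
      borel_measurable_norm_powr_on_ball[OF bounded_linear.continuous_on[OF bounded_linear_cnj_bc_plus contf]]
    by (cases b) (simp_all add: v_def)
  have "(\<integral>\<^sup>+z\<in>ball 0 1. ennreal (norm (f z) powr m) \<partial>lborel)
      \<le> ennreal (card (UNIV :: bool set) powr m) * (\<Sum>b\<in>UNIV. \<integral>\<^sup>+z\<in>ball 0 1. ennreal (v b z powr m) \<partial>lborel)"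
    using assms(4) vmeas norm_bicomplex_le
    by (intro nn_integral_powr_sum_le) (auto simp: v_def UNIV_bool add.commute)
  also have "\<dots> < \<infinity>" using vfin by (auto simp: ennreal_mult_less_top)
  finally have "(\<integral>\<^sup>+z. ennreal (norm (f z) powr m) \<partial>lebesgue_on (ball 0 1)) < \<infinity>"
    by (simp add: nn_integral_restrict_space nn_integral_completion)
  moreover have "f \<in> borel_measurable (lebesgue_on (ball 0 1))"
  proof -
    have "f \<in> borel_measurable (restrict_space borel (ball 0 1))"
      using contf by (rule borel_measurable_continuous_on_restrict)
    then show ?thesis
      by (auto simp: measurable_def space_restrict_space sets_restrict_space)
  qed
  ultimately show ?thesis by (simp add: L_space_def)
qed

end
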